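(* Let $S$ be an ordered semigroup satisfying axioms O1–O5. Then $S_{\mathbb{R}}$ also satisfies O1–O5, and $\mathrm{F}(S)\cong \mathrm{F}(S_{\mathbb{R}})$ as topological cones.
   Context: An ordered semigroup is an abelian monoid with a translation invariant order relation in which $0$ is the smallest element. For $s,t$ in an ordered set, $s\ll t$ means: for every increasing sequence $(t_n)$ (having a supremum) with $t\leq \sup_n t_n$ there is $n_0$ with $s\leq t_{n_0}$. Axioms on an ordered semigroup $S$: O1: every increasing sequence has a supremum. O2: every $s\in S$ is the supremum of a sequence $(s_n)$ with $s_n\ll s_{n+1}$ for all $n$. O3: if $s_i\ll t_i$ for $i=1,2$ then $s_1+s_2\ll t_1+t_2$. O4: if $(s_n),(t_n)$ are increasing then $\sup_n(s_n+t_n)=\sup_n s_n+\sup_n t_n$. O5: if $s'\ll s\leq t$ then there exists $r$ with $s'+r\leq t\leq s+r$. A functional on $S$ is a map $\lambda\colon S\to[0,\infty]$ that is additive, order preserving, sends $0$ to $0$, and preserves suprema of increasing sequences. $\mathrm{F}(S)$ is the cone of all functionals (pointwise addition and multiplication by positive reals), with the topology in which a net $(\lambda_i)$ converges to $\lambda$ iff $\limsup_i\lambda_i(s')\leq\lambda(s)\leq\liminf_i\lambda_i(s)$ for all $s',s\in S$ with $s'\ll s$. An isomorphism of topological cones is a bijection that is additive, commutes with multiplication by positive reals, and is a homeomorphism. $\mathrm{Lsc}(\mathrm{F}(S))$ is the set of lower semicontinuous functions $f\colon\mathrm{F}(S)\to[0,\infty]$ that are linear (additive, homogeneous for positive real scalars,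 $f(0)=0$), with pointwise order, addition, and scalar multiplication. For $s\in S$, $\hat s\in\mathrm{Lsc}(\mathrm{F}(S))$ is $\hat s(\lambda)=\lambda(s)$. $S_{\mathbb{R}}\subseteq \mathrm{Lsc}(\mathrm{F}(S))$ is the set of functions $f$ for which there are $s_i\in S$ and positive integers $n_i$ ($i=1,2,\dots$) such that the sequence $(\hat s_i/n_i)_i$ is increasing and $f(\lambda)=\sup_i \hat s_i(\lambda)/n_i$ for all $\lambda\in\mathrm{F}(S)$. It is an ordered semigroup with the operations and order of $\mathrm{Lsc}(\mathrm{F}(S))$. *)

theory Defs
  imports
    "HOL-Algebra.Group"
    "HOL-Analysis.Abstract_Limits"
    "HOL-Library.Extended_Nonnegative_Real"
begin

section \<open>Ordered semigroups\<close>

record 'a osg = "'a gorder" +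
  osg_zero :: 'a (\<open>\<zero>\<index>\<close>)
  osg_add :: "['a, 'a] \<Rightarrow> 'a" (infixl \<open>\<oplus>\<index>\<close> 65)

definition osg_monoid :: "'a osg \<Rightarrow> 'a monoid" where
  "osg_monoid S = \<lparr>carrier = carrier S, mult = osg_add S, one = osg_zero S\<rparr>"

locale ordered_semigroup = partial_order S for S :: "'a osg" (structure) +
  assumes comm_monoid_add: "comm_monoid (osg_monoid S)"
    and add_right_mono:
      "\<lbrakk>x \<in> carrier S; y \<in> carrier S; z \<in> carrier S; x \<sqsubseteq> y\<rbrakk> \<Longrightarrow> x \<oplus> z \<sqsubseteq> y \<oplus> z"
    and zero_least: "x \<in> carrier S \<Longrightarrow> \<zero> \<sqsubseteq> x"

definition increasing :: "'a osg \<Rightarrow> (nat \<Rightarrow> 'a) \<Rightarrow> bool" where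
  "increasing S s \<longleftrightarrow> (\<forall>n. s n \<in> carrier S) \<and> (\<forall>n. s n \<sqsubseteq>\<^bsub>S\<^esub> s (Suc n))"

definition is_seq_sup :: "'a osg \<Rightarrow> (nat \<Rightarrow> 'a) \<Rightarrow> 'a \<Rightarrow> bool" where
  "is_seq_sup S s x \<longleftrightarrow> least S x (Upper S (range s))"

definition way_below :: "'a osg \<Rightarrow> 'a \<Rightarrow> 'a \<Rightarrow> bool" where
  "way_below S x y \<longleftrightarrow>
     (\<forall>t u. increasing S t \<and> is_seq_sup S t u \<and> y \<sqsubseteq>\<^bsub>S\<^esub> u \<longrightarrow> (\<exists>n. x \<sqsubseteq>\<^bsub>S\<^esub> t n))"

definition axiom_O1 :: "'a osg \<Rightarrow> bool" where
  "axiom_O1 S \<longleftrightarrow> (\<forall>s. increasing S s \<longrightarrow> (\<exists>x. is_seq_sup S s x))"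

definition axiom_O2 :: "'a osg \<Rightarrow> bool" where
  "axiom_O2 S \<longleftrightarrow>
     (\<forall>x\<in>carrier S. \<exists>s. (\<forall>n. s n \<in> carrier S) \<and>
        (\<forall>n. way_below S (s n) (s (Suc n))) \<and> is_seq_sup S s x)"

definition axiom_O3 :: "'a osg \<Rightarrow> bool" where
  "axiom_O3 S \<longleftrightarrow>
     (\<forall>s\<^sub>1\<in>carrier S. \<forall>t\<^sub>1\<in>carrier S. \<forall>s\<^sub>2\<in>carrier S. \<forall>t\<^sub>2\<in>carrier S.
        way_below S s\<^sub>1 t\<^sub>1 \<and> way_below S s\<^sub>2 t\<^sub>2 \<longrightarrow>
        way_below S (s\<^sub>1 \<oplus>\<^bsub>S\<^esub> s\<^sub>2) (t\<^sub>1 \<oplus>\<^bsub>S\<^esub> t\<^sub>2))"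

definition axiom_O4 :: "'a osg \<Rightarrow> bool" where
  "axiom_O4 S \<longleftrightarrow>
     (\<forall>s t x y. increasing S s \<and> increasing S t \<and> is_seq_sup S s x \<and> is_seq_sup S t y \<longrightarrow>
        is_seq_sup S (\<lambda>n. s n \<oplus>\<^bsub>S\<^esub> t n) (x \<oplus>\<^bsub>S\<^esub> y))"

definition axiom_O5 :: "'a osg \<Rightarrow> bool" where
  "axiom_O5 S \<longleftrightarrow>
     (\<forall>s'\<in>carrier S. \<forall>s\<in>carrier S. \<forall>t\<in>carrier S. way_below S s' s \<and> s \<sqsubseteq>\<^bsub>S\<^esub> t \<longrightarrow>
        (\<exists>r\<in>carrier S. s' \<oplus>\<^bsub>S\<^esub> r \<sqsubseteq>\<^bsub>S\<^esub> t \<and> t \<sqsubseteq>\<^bsub>S\<^esub> s \<oplus>\<^bsub>S\<^esub> r))"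


section \<open>The cone of functionals\<close>

text \<open>Maps are made \<^const>\<open>extensional\<close> so that equality of maps is equality on the domain.\<close>

definition functionals :: "'a osg \<Rightarrow> ('a \<Rightarrow> ennreal) set" where
  "functionals S = {l \<in> extensional (carrier S).
     l \<zero>\<^bsub>S\<^esub> = 0 \<and>
     (\<forall>x\<in>carrier S. \<forall>y\<in>carrier S. l (x \<oplus>\<^bsub>S\<^esub> y) = l x + l y) \<and>
     (\<forall>x\<in>carrier S. \<forall>y\<in>carrier S. x \<sqsubseteq>\<^bsub>S\<^esub> y \<longrightarrow> l x \<le> l y) \<and>
     (\<forall>s x. increasing S s \<and> is_seq_sup S s x \<longrightarrow> l x = (SUP n. l (s n)))}"

definition functional_zero :: "'a osg \<Rightarrow> 'a \<Rightarrow> ennreal" where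
  "functional_zero S = (\<lambda>x\<in>carrier S. 0)"

definition functional_add :: "'a osg \<Rightarrow> ('a \<Rightarrow> ennreal) \<Rightarrow> ('a \<Rightarrow> ennreal) \<Rightarrow> 'a \<Rightarrow> ennreal" where
  "functional_add S l m = (\<lambda>x\<in>carrier S. l x + m x)"

definition functional_scale :: "'a osg \<Rightarrow> real \<Rightarrow> ('a \<Rightarrow> ennreal) \<Rightarrow> 'a \<Rightarrow> ennreal" where
  "functional_scale S c l = (\<lambda>x\<in>carrier S. ennreal c * l x)"

definition functionals_converge ::
    "'a osg \<Rightarrow> ('i \<Rightarrow> 'a \<Rightarrow> ennreal) \<Rightarrow> ('a \<Rightarrow> ennreal) \<Rightarrow> 'i filter \<Rightarrow> bool" where
  "functionals_converge S f l \<Phi> \<longleftrightarrow>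
     l \<in> functionals S \<and> eventually (\<lambda>i. f i \<in> functionals S) \<Phi> \<and>
     (\<forall>s'\<in>carrier S. \<forall>s\<in>carrier S. way_below S s' s \<longrightarrow>
        Limsup \<Phi> (\<lambda>i. f i s') \<le> l s \<and> l s \<le> Liminf \<Phi> (\<lambda>i. f i s))"

text \<open>Nets are rendered as filters. A topology is determined by its convergent nets: a set is
  open iff every net converging to one of its points is eventually in it. That the topology so
  defined has exactly the prescribed convergence is lemma \<open>limitin_functional_topology\<close> below.\<close>

definition functional_open :: "'a osg \<Rightarrow> ('a \<Rightarrow> ennreal) set \<Rightarrow> bool" where
  "functional_open S U \<longleftrightarrow> U \<subseteq> functionals S \<and>
     (\<forall>l\<in>U. \<forall>\<Phi>. functionals_converge S (\<lambda>m. m) l \<Phi> \<longrightarrow> eventually (\<lambda>m. m \<in> U) \<Phi>)"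

definition functional_topology :: "'a osg \<Rightarrow> ('a \<Rightarrow> ennreal) topology" where
  "functional_topology S = topology (functional_open S)"

record 'a top_cone =
  cone_topology :: "'a topology"
  cone_add :: "'a \<Rightarrow> 'a \<Rightarrow> 'a"
  cone_scale :: "real \<Rightarrow> 'a \<Rightarrow> 'a"

definition functional_cone :: "'a osg \<Rightarrow> ('a \<Rightarrow> ennreal) top_cone" where
  "functional_cone S = \<lparr>cone_topology = functional_topology S,
     cone_add = functional_add S, cone_scale = functional_scale S\<rparr>"

definition top_cone_iso :: "'a top_cone \<Rightarrow> 'b top_cone \<Rightarrow> ('a \<Rightarrow> 'b) \<Rightarrow> bool" where
  "top_cone_iso C D \<phi> \<longleftrightarrow>
     bij_betw \<phi> (topspace (cone_topology C)) (topspace (cone_topology D)) \<and>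
     (\<forall>x\<in>topspace (cone_topology C). \<forall>y\<in>topspace (cone_topology C).
        \<phi> (cone_add C x y) = cone_add D (\<phi> x) (\<phi> y)) \<and>
     (\<forall>c>0. \<forall>x\<in>topspace (cone_topology C). \<phi> (cone_scale C c x) = cone_scale D c (\<phi> x)) \<and>
     homeomorphic_map (cone_topology C) (cone_topology D) \<phi>"

definition top_cone_isomorphic :: "'a top_cone \<Rightarrow> 'b top_cone \<Rightarrow> bool"
    (infix \<open>\<cong>\<^sub>c\<close> 50) where
  "C \<cong>\<^sub>c D \<longleftrightarrow> (\<exists>\<phi>. top_cone_iso C D \<phi>)"


section \<open>Lower semicontinuous functions and the realification\<close>

definition Lsc :: "'a osg \<Rightarrow> (('a \<Rightarrow> ennreal) \<Rightarrow> ennreal) set" where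
  "Lsc S = {f \<in> extensional (functionals S).
     (\<forall>a. openin (functional_topology S) {l \<in> functionals S. a < f l}) \<and>
     f (functional_zero S) = 0 \<and>
     (\<forall>l\<in>functionals S. \<forall>m\<in>functionals S. f (functional_add S l m) = f l + f m) \<and>
     (\<forall>c>0. \<forall>l\<in>functionals S. f (functional_scale S c l) = ennreal c * f l)}"

definition hat :: "'a osg \<Rightarrow> 'a \<Rightarrow> ('a \<Rightarrow> ennreal) \<Rightarrow> ennreal" where
  "hat S s = (\<lambda>l\<in>functionals S. l s)"

definition realification :: "'a osg \<Rightarrow> (('a \<Rightarrow> ennreal) \<Rightarrow> ennreal) osg" where
  "realification S = \<lparr>
     carrier = {f \<in> Lsc S. \<exists>(s :: nat \<Rightarrow> 'a) (n :: nat \<Rightarrow> nat).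
       (\<forall>i. s i \<in> carrier S \<and> 0 < n i) \<and>
       (\<forall>i. \<forall>l\<in>functionals S.
          hat S (s i) l / of_nat (n i) \<le> hat S (s (Suc i)) l / of_nat (n (Suc i))) \<and>
       (\<forall>l\<in>functionals S. f l = (SUP i. hat S (s i) l / of_nat (n i)))},
     eq = (=),
     le = (\<lambda>f g. \<forall>l\<in>functionals S. f l \<le> g l),
     osg_zero = (\<lambda>l\<in>functionals S. 0),
     osg_add = (\<lambda>f g. \<lambda>l\<in>functionals S. f l + g l)\<rparr>"


section \<open>Adequacy of the topology\<close>

lemma istopology_functional_open: "istopology (functional_open S)"
  unfolding istopology_def functional_open_def
proof (intro conjI allI impI, goal_cases)
  case (1 A B) then show ?case by blast
next
  case (2 A B) then show ?case by (auto intro: eventually_conj)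
next
  case (3 K) then show ?case by blast
next
  case (4 K)
  show ?case
  proof (intro ballI allI impI)
    fix l \<Phi> assume "l \<in> \<Union>K" "functionals_converge S (\<lambda>m. m) l \<Phi>"
    then obtain U where "U \<in> K" "eventually (\<lambda>m. m \<in> U) \<Phi>" using 4 by blast
    then show "eventually (\<lambda>m. m \<in> \<Union>K) \<Phi>" by (auto elim: eventually_mono)
  qed
qed

lemma openin_functional_topology: "openin (functional_topology S) U \<longleftrightarrow> functional_open S U"
  by (simp add: functional_topology_def istopology_functional_open)

lemma topspace_functional_topology: "topspace (functional_topology S) = functionals S"
proof -
  have "functional_open S (functionals S)"
    by (auto simp: functional_open_def functionals_converge_def)
  then show ?thesis
    unfolding topspace_def openin_functional_topology by (auto simp: functional_open_def)
qed

lemma functionals_converge_filtermap: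
  "functionals_converge S f l \<Phi> \<longleftrightarrow> functionals_converge S (\<lambda>m. m) l (filtermap f \<Phi>)"
  by (simp add: functionals_converge_def eventually_filtermap le_Liminf_iff Limsup_le_iff)

context ordered_semigroup
begin

lemma way_below_imp_le:
  assumes "x \<in> carrier S" "y \<in> carrier S" "way_below S x y"
  shows "x \<sqsubseteq> y"
proof -
  have "increasing S (\<lambda>_. y)" "is_seq_sup S (\<lambda>_. y) y"
    using assms by (auto simp: increasing_def is_seq_sup_def least_def Upper_def)
  then show ?thesis using assms unfolding way_below_def by blast
qed

lemma way_below_le_trans:
  assumes "way_below S x y" "y \<sqsubseteq> z" "y \<in> carrier S" "z \<in> carrier S"
  shows "way_below S x z"
  unfolding way_below_def
proof (intro allI impI)
  fix t u assume tu: "increasing S t \<and> is_seq_sup S t u \<and> z \<sqsubseteq> u"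
  then have "u \<in> carrier S" by (auto simp: is_seq_sup_def least_def Upper_def)
  then have "y \<sqsubseteq> u" using tu assms le_trans by blast
  then show "\<exists>n. x \<sqsubseteq> t n" using tu assms unfolding way_below_def by blast
qed

lemma le_way_below_trans:
  assumes "x \<sqsubseteq> y" "way_below S y z" "x \<in> carrier S" "y \<in> carrier S"
  shows "way_below S x z"
  unfolding way_below_def
proof (intro allI impI)
  fix t u assume tu: "increasing S t \<and> is_seq_sup S t u \<and> z \<sqsubseteq> u"
  then obtain n where "y \<sqsubseteq> t n" "t n \<in> carrier S"
    using assms unfolding way_below_def increasing_def by blast
  then show "\<exists>n. x \<sqsubseteq> t n" using assms le_trans by blast
qed

lemma way_below_interpolate:
  assumes "axiom_O2 S" "x \<in> carrier S" "y \<in> carrier S" "way_below S x y"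
  obtains z where "z \<in> carrier S" "way_below S x z" "way_below S z y"
proof -
  obtain s where s: "\<And>n. s n \<in> carrier S" "\<And>n. way_below S (s n) (s (Suc n))" "is_seq_sup S s y"
    using assms unfolding axiom_O2_def by blast
  have "increasing S s" using s way_below_imp_le by (auto simp: increasing_def)
  then obtain n where n: "x \<sqsubseteq> s n"
    using assms s le_refl unfolding way_below_def by blast
  have "s (Suc (Suc n)) \<sqsubseteq> y" using s by (auto simp: is_seq_sup_def least_def Upper_def)
  then have "way_below S (s (Suc n)) y" using s assms way_below_le_trans by blast
  moreover have "way_below S x (s (Suc n))" using n s assms le_way_below_trans by blast
  ultimately show ?thesis using that s by blast
qed

lemma limitin_functional_topology:
  assumes O2: "axiom_O2 S"
  shows "limitin (functional_topology S) f l \<Phi> \<longleftrightarrow> functionals_converge S f l \<Phi>"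
proof
  assume c: "functionals_converge S f l \<Phi>"
  then have "functionals_converge S (\<lambda>m. m) l (filtermap f \<Phi>)"
    by (simp flip: functionals_converge_filtermap)
  then have "eventually (\<lambda>m. m \<in> U) (filtermap f \<Phi>)" if "functional_open S U" "l \<in> U" for U
    using that unfolding functional_open_def by blast
  moreover have "l \<in> functionals S" using c by (simp add: functionals_converge_def)
  ultimately show "limitin (functional_topology S) f l \<Phi>"
    by (simp add: limitin_def topspace_functional_topology openin_functional_topology
        eventually_filtermap)
next
  let ?F = "functionals S"
  assume lim: "limitin (functional_topology S) f l \<Phi>"
  have l: "l \<in> ?F" using limitin_topspace[OF lim] by (simp add: topspace_functional_topology)
  have F: "eventually (\<lambda>i. f i \<in> ?F) \<Phi>"
    using limitinD[OF lim openin_topspace] l by (simp add: topspace_functional_topology)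
  have lower: "functional_open S {m \<in> ?F. a < m s}" if "s \<in> carrier S" for s a
    unfolding functional_open_def
  proof (intro conjI ballI allI impI)
    fix k \<Psi> assume k: "k \<in> {m \<in> ?F. a < m s}" and c: "functionals_converge S (\<lambda>m. m) k \<Psi>"
    obtain s' where "s' \<in> carrier S" "way_below S s' s"
    proof -
      obtain t where t: "\<And>n. t n \<in> carrier S" "\<And>n. way_below S (t n) (t (Suc n))"
        "is_seq_sup S t s"
        using O2 \<open>s \<in> carrier S\<close> unfolding axiom_O2_def by blast
      moreover have "t 1 \<sqsubseteq> s" using t by (auto simp: is_seq_sup_def least_def Upper_def)
      ultimately have "way_below S (t 0) s"
        using way_below_le_trans[of "t 0" "t 1" s] t(2)[of 0] \<open>s \<in> carrier S\<close> by simp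
      then show thesis using t that by blast
    qed
    then have "k s \<le> Liminf \<Psi> (\<lambda>m. m s)" "eventually (\<lambda>m. m \<in> ?F) \<Psi>"
      using c \<open>s \<in> carrier S\<close> by (auto simp: functionals_converge_def)
    then show "eventually (\<lambda>m. m \<in> {m \<in> ?F. a < m s}) \<Psi>"
      using k by (auto simp: le_Liminf_iff intro: eventually_conj)
  qed auto
  have upper: "functional_open S {m \<in> ?F. \<exists>s\<in>carrier S. way_below S s' s \<and> m s < a}"
    (is "functional_open S ?U") if s': "s' \<in> carrier S" for s' a
    unfolding functional_open_def
  proof (intro conjI ballI allI impI)
    fix k \<Psi> assume k: "k \<in> ?U" and c: "functionals_converge S (\<lambda>m. m) k \<Psi>"
    then obtain s where s: "s \<in> carrier S" "way_below S s' s" "k s < a" by blast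
    obtain z where z: "z \<in> carrier S" "way_below S s' z" "way_below S z s"
      using way_below_interpolate[OF O2 s' s(1,2)] by blast
    have "Limsup \<Psi> (\<lambda>m. m z) \<le> k s" "eventually (\<lambda>m. m \<in> ?F) \<Psi>"
      using c z s by (auto simp: functionals_converge_def)
    then have "eventually (\<lambda>m. m \<in> ?F \<and> m z < a) \<Psi>"
      using s by (auto simp: Limsup_le_iff intro: eventually_conj)
    then show "eventually (\<lambda>m. m \<in> ?U) \<Psi>"
      by (rule eventually_mono) (use z in blast)
  qed auto
  have "Limsup \<Phi> (\<lambda>i. f i s') \<le> l s \<and> l s \<le> Liminf \<Phi> (\<lambda>i. f i s)"
    if s: "s' \<in> carrier S" "s \<in> carrier S" "way_below S s' s" for s' s
    unfolding le_Liminf_iff Limsup_le_iff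
  proof (intro conjI allI impI)
    fix a assume "l s < a"
    then have "eventually (\<lambda>i. f i \<in> {m \<in> ?F. \<exists>s\<in>carrier S. way_below S s' s \<and> m s < a}) \<Phi>"
      using limitinD[OF lim, unfolded openin_functional_topology, OF upper] s l by blast
    then show "eventually (\<lambda>i. f i s' < a) \<Phi>"
    proof (rule eventually_mono)
      fix i assume "f i \<in> {m \<in> ?F. \<exists>s\<in>carrier S. way_below S s' s \<and> m s < a}"
      then obtain t where t: "f i \<in> ?F" "t \<in> carrier S" "way_below S s' t" "f i t < a" by blast
      then have "f i s' \<le> f i t" using s way_below_imp_le by (auto simp: functionals_def)
      then show "f i s' < a" using t by simp
    qed
  next
    fix a assume "a < l s"
    then have "eventually (\<lambda>i. f i \<in> {m \<in> ?F. a < m s}) \<Phi>"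
      using limitinD[OF lim, unfolded openin_functional_topology, OF lower] s l by blast
    then show "eventually (\<lambda>i. a < f i s) \<Phi>" by (rule eventually_mono) simp
  qed
  then show "functionals_converge S f l \<Phi>"
    using l F by (simp add: functionals_converge_def)
qed

end

end

theory Submission
  imports Defs
begin

text \<open>Below a \<open>[0,\<infinity>]\<close>-valued sublinear function there is, by a Hahn--Banach argument, an additive one
  with the same value at a given point, and replacing an additive \<open>p\<close> by the supremum of
  \<open>p x'\<close> over all \<open>x'\<close> way below \<open>x\<close> makes it preserve suprema. Testing with these
  functionals shows: if \<open>s'\<close> is way below \<open>s\<close>, \<open>c < d\<close>, and the multiple \<open>d s\<close> is pointwise at most
  the supremum of an increasing sequence \<open>g\<^sub>i\<close> of the realification, then \<open>c s'\<close> is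
  at most some \<open>g\<^sub>i\<close>. So \<open>c s'\<close> is way below \<open>d s\<close> in the realification, and every element of the
  realification is a pointwise supremum of a way-below increasing sequence of such multiples. All
  axioms but O5, and the fact that a functional of the realification is determined by
  its values on \<open>S\<close>, follow from this. For O5, complements of multiples come from O5 in \<open>S\<close> and are
  glued along a sequence.\<close>

hide_const (open) Order.top Order.bottom

section \<open>Sublinear functions on ordered semigroups\<close>

text \<open>Three obstacles shape the proof. An inequality that holds under all functionals need not
  hold in \<open>S\<close>; it is recovered only for integer multiples, after passing to a way-below
  element and giving up a factor close to 1. This is where the strict inequality c < d comes from.
  The sublinear functions used as tests are gauges: the gauge of x is the infimum of the factors a
  such that x lies below a times a fixed element, or below a times some member of a fixed sequence.
  If the wanted domination fails, the gauge is too large at \<open>s'\<close>, and a functional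
  below the gauge that keeps this value violates the assumed pointwise inequality. Values may be
  infinite, so nothing can be cancelled or subtracted before finiteness is secured; a direction in
  which a sublinear function is infinite is additive for trivial reasons. Finally, it is not evident
  that an increasing sequence of the realification has its pointwise supremum there: its members
  come with separate approximating sequences, and a diagonal through such an array need not
  increase. Rows that are way-below chains can be interleaved.\<close>

definition osg_mult :: "'a osg \<Rightarrow> nat \<Rightarrow> 'a \<Rightarrow> 'a" (\<open>(_ \<odot>\<index> _)\<close> [81,81] 80) where
  "n \<odot>\<^bsub>S\<^esub> x = ((\<lambda>y. y \<oplus>\<^bsub>S\<^esub> x) ^^ n) \<zero>\<^bsub>S\<^esub>"

lemma osg_mult_simps [simp]:
  "0 \<odot>\<^bsub>S\<^esub> x = \<zero>\<^bsub>S\<^esub>" "Suc n \<odot>\<^bsub>S\<^esub> x = n \<odot>\<^bsub>S\<^esub> x \<oplus>\<^bsub>S\<^esub> x"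
  by (simp_all add: osg_mult_def)

context ordered_semigroup
begin

sublocale osg: comm_monoid "osg_monoid S"
  rewrites "carrier (osg_monoid S) = carrier S"
    and "mult (osg_monoid S) = osg_add S"
    and "one (osg_monoid S) = osg_zero S"
  by (rule comm_monoid_add) (simp_all add: osg_monoid_def)

lemma osg_add_mono:
  assumes "x \<in> carrier S" "y \<in> carrier S" "x' \<in> carrier S" "y' \<in> carrier S" "x \<sqsubseteq> x'" "y \<sqsubseteq> y'"
  shows "x \<oplus> y \<sqsubseteq> x' \<oplus> y'"
proof -
  have "x \<oplus> y \<sqsubseteq> x' \<oplus> y" using assms by (intro add_right_mono)
  also have "y \<oplus> x' \<sqsubseteq> y' \<oplus> x'" using assms by (intro add_right_mono)
  then have "x' \<oplus> y \<sqsubseteq> x' \<oplus> y'" using assms by (simp add: osg.m_comm)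
  finally show ?thesis using assms by simp
qed

lemma le_add:
  assumes "x \<in> carrier S" "y \<in> carrier S"
  shows "x \<sqsubseteq> x \<oplus> y"
  using osg_add_mono[of x \<zero> x y] zero_least assms by auto

lemma osg_mult_closed [simp, intro]: "x \<in> carrier S \<Longrightarrow> n \<odot> x \<in> carrier S"
  by (induction n) auto

lemma osg_mult_add_left: "x \<in> carrier S \<Longrightarrow> (m + n) \<odot> x = m \<odot> x \<oplus> n \<odot> x"
  by (induction n) (auto simp: osg.m_assoc)

lemma osg_mult_mult: "x \<in> carrier S \<Longrightarrow> (m * n) \<odot> x = m \<odot> (n \<odot> x)"
proof (induction m)
  case (Suc m)
  have "(Suc m * n) \<odot> x = (m * n + n) \<odot> x" by (simp add: add.commute)
  then show ?case using Suc by (simp only: osg_mult_add_left osg_mult_simps)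
qed simp

lemma osg_mult_add_right:
  "x \<in> carrier S \<Longrightarrow> y \<in> carrier S \<Longrightarrow> n \<odot> (x \<oplus> y) = n \<odot> x \<oplus> n \<odot> y"
  by (induction n) (auto simp: osg.m_ac)

lemma osg_mult_mono: "x \<in> carrier S \<Longrightarrow> y \<in> carrier S \<Longrightarrow> x \<sqsubseteq> y \<Longrightarrow> n \<odot> x \<sqsubseteq> n \<odot> y"
  by (induction n) (auto intro: osg_add_mono)

lemma osg_mult_mono_left: "x \<in> carrier S \<Longrightarrow> m \<le> n \<Longrightarrow> m \<odot> x \<sqsubseteq> n \<odot> x"
  using le_add osg_mult_add_left[of x m "n - m"] by simp

lemma zero_way_below: "way_below S \<zero> x"
  unfolding way_below_def increasing_def using zero_least by blast

end

text \<open>Only natural multiples exist in \<open>S\<close>, so homogeneity is asked for these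
  alone, and only as the inequality that subadditivity does not supply;
  \<open>sublinear_mult\<close> gives the equality. Infinite values are allowed.\<close>

definition sublinear :: "'a osg \<Rightarrow> ('a \<Rightarrow> ennreal) \<Rightarrow> bool" where
  "sublinear S p \<longleftrightarrow> p \<zero>\<^bsub>S\<^esub> = 0 \<and>
     (\<forall>x\<in>carrier S. \<forall>y\<in>carrier S. p (x \<oplus>\<^bsub>S\<^esub> y) \<le> p x + p y) \<and>
     (\<forall>x\<in>carrier S. \<forall>y\<in>carrier S. x \<sqsubseteq>\<^bsub>S\<^esub> y \<longrightarrow> p x \<le> p y) \<and>
     (\<forall>n. \<forall>x\<in>carrier S. of_nat n * p x \<le> p (n \<odot>\<^bsub>S\<^esub> x))"

lemma sublinearI:
  assumes "p \<zero>\<^bsub>S\<^esub> = 0"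
    and "\<And>x y. x \<in> carrier S \<Longrightarrow> y \<in> carrier S \<Longrightarrow> p (x \<oplus>\<^bsub>S\<^esub> y) \<le> p x + p y"
    and "\<And>x y. x \<in> carrier S \<Longrightarrow> y \<in> carrier S \<Longrightarrow> x \<sqsubseteq>\<^bsub>S\<^esub> y \<Longrightarrow> p x \<le> p y"
    and "\<And>n x. 0 < n \<Longrightarrow> x \<in> carrier S \<Longrightarrow> of_nat n * p x \<le> p (n \<odot>\<^bsub>S\<^esub> x)"
  shows "sublinear S p"
proof -
  have "of_nat n * p x \<le> p (n \<odot>\<^bsub>S\<^esub> x)" if "x \<in> carrier S" for n x
    using assms that by (cases "n = 0") auto
  then show ?thesis using assms by (auto simp: sublinear_def)
qed

section \<open>Truncated differences and infima in [0, infinity]\<close>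

lemma le_add_diff_ennreal: "a \<le> b + (a - b)" for a b :: ennreal
  using ennreal_minus_le_iff[of a b "a - b"] by simp

text \<open>Subtraction is truncated, so the comparison is derived from
  \<open>le_add_diff_ennreal\<close>; finiteness of b and d excludes infinity minus infinity when
  their sum is moved across.\<close>

lemma ennreal_diff_add_diff_ge:
  fixes a b c d :: ennreal
  assumes "b < top" "d < top"
  shows "(a + c) - (b + d) \<le> (a - b) + (c - d)"
proof -
  have "a \<le> b + (a - b)" "c \<le> d + (c - d)" by (simp_all add: le_add_diff_ennreal)
  then have "a + c \<le> (b + (a - b)) + (d + (c - d))" by (rule add_mono)
  also have "\<dots> = (b + d) + ((a - b) + (c - d))" by (simp only: ac_simps)
  finally show ?thesis using assms by (auto simp: ennreal_minus_le_iff)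
qed

text \<open>Both infima are approximated within e/2. This is the source of subadditivity for every
  function defined as an infimum: \<open>additive_along\<close>, infima of chains, and both
  gauges.\<close>

lemma INF_add_INF_le_ennreal:
  fixes f g :: "_ \<Rightarrow> ennreal"
  assumes "\<And>i j. i \<in> I \<Longrightarrow> j \<in> J \<Longrightarrow> c \<le> f i + g j" "I \<noteq> {}" "J \<noteq> {}"
  shows "c \<le> (INF i\<in>I. f i) + (INF j\<in>J. g j)"
proof (rule ennreal_le_epsilon)
  fix e :: real assume fin: "(INF i\<in>I. f i) + (INF j\<in>J. g j) < top" and e: "0 < e"
  have fin': "(INF i\<in>I. f i) \<noteq> \<infinity>" "(INF j\<in>J. g j) \<noteq> \<infinity>"
    using fin by (auto simp: less_top[symmetric])
  obtain i where i: "i \<in> I" "f i < (INF i\<in>I. f i) + ennreal (e/2)"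
    using INF_approx_ennreal[OF half_gt_zero[OF e] refl fin'(1)] by blast
  obtain j where j: "j \<in> J" "g j < (INF j\<in>J. g j) + ennreal (e/2)"
    using INF_approx_ennreal[OF half_gt_zero[OF e] refl fin'(2)] by blast
  have "c \<le> f i + g j" using assms i j by blast
  also have "\<dots> \<le> ((INF i\<in>I. f i) + ennreal (e/2)) + ((INF j\<in>J. g j) + ennreal (e/2))"
    using i j by (intro add_mono) auto
  also have "\<dots> = (INF i\<in>I. f i) + (INF j\<in>J. g j) + (ennreal (e/2) + ennreal (e/2))"
    by (simp add: ac_simps)
  also have "ennreal (e/2) + ennreal (e/2) = ennreal e" using e by (simp flip: ennreal_plus)
  finally show "c \<le> (INF i\<in>I. f i) + (INF j\<in>J. g j) + ennreal e" .
qed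

context ordered_semigroup
begin

lemma
  assumes "sublinear S p"
  shows sublinear_zero: "p \<zero> = 0"
    and sublinear_add: "x \<in> carrier S \<Longrightarrow> y \<in> carrier S \<Longrightarrow> p (x \<oplus> y) \<le> p x + p y"
    and sublinear_mono: "x \<in> carrier S \<Longrightarrow> y \<in> carrier S \<Longrightarrow> x \<sqsubseteq> y \<Longrightarrow> p x \<le> p y"
    and sublinear_mult_ge: "x \<in> carrier S \<Longrightarrow> of_nat n * p x \<le> p (n \<odot> x)"
  using assms by (auto simp: sublinear_def)

lemma sublinear_mult:
  assumes "sublinear S p" "x \<in> carrier S"
  shows "p (n \<odot> x) = of_nat n * p x"
proof (rule antisym)
  show "p (n \<odot> x) \<le> of_nat n * p x"
  proof (induction n)
    case (Suc n)
    have "p (n \<odot> x \<oplus> x) \<le> p (n \<odot> x) + p x" using assms by (intro sublinear_add) auto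
    also have "\<dots> \<le> of_nat n * p x + p x" using Suc by (intro add_mono) auto
    finally show ?case by (simp add: distrib_right add.commute)
  qed (use assms sublinear_zero in auto)
qed (rule sublinear_mult_ge[OF assms])

text \<open>Raising the index from m to n adds (n - m) z to the argument. By subadditivity this
  costs at most (n - m) p z, exactly the growth of the subtracted term.\<close>

lemma sublinear_sum_diff_antimono:
  assumes p: "sublinear S p" and x: "x \<in> carrier S" and z: "z \<in> carrier S" "p z < top" and "m \<le> n"
  shows "p (x \<oplus> n \<odot> z) - of_nat n * p z \<le> p (x \<oplus> m \<odot> z) - of_nat m * p z"
proof -
  have fin: "of_nat k * p z < top" for k using z by (simp add: ennreal_mult_less_top of_nat_less_top)
  have eq: "x \<oplus> n \<odot> z = (x \<oplus> m \<odot> z) \<oplus> (n - m) \<odot> z"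
    using osg_mult_add_left[of z m "n - m"] \<open>m \<le> n\<close> x z by (simp add: osg.m_assoc)
  have "p (x \<oplus> n \<odot> z) \<le> p (x \<oplus> m \<odot> z) + p ((n - m) \<odot> z)"
    unfolding eq using x z by (intro sublinear_add[OF p]) auto
  also have "p ((n - m) \<odot> z) = of_nat (n - m) * p z" using sublinear_mult[OF p z(1)] .
  also have "p (x \<oplus> m \<odot> z) \<le> of_nat m * p z + (p (x \<oplus> m \<odot> z) - of_nat m * p z)"
    by (rule le_add_diff_ennreal)
  finally have "p (x \<oplus> n \<odot> z) \<le>
      of_nat m * p z + of_nat (n - m) * p z + (p (x \<oplus> m \<odot> z) - of_nat m * p z)"
    by (simp add: ac_simps)
  also have "of_nat m * p z + of_nat (n - m) * p z = of_nat n * p z"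
    using \<open>m \<le> n\<close> by (simp flip: distrib_right of_nat_add)
  finally show ?thesis using fin[of n] by (auto simp: ennreal_minus_le_iff)
qed

text \<open>The Hahn--Banach step: a minimal sublinear \<open>p\<close> equals \<open>additive_along p z\<close>, hence is
  additive in the direction \<open>z\<close>.\<close>

definition additive_along :: "('a \<Rightarrow> ennreal) \<Rightarrow> 'a \<Rightarrow> 'a \<Rightarrow> ennreal" where
  "additive_along p z x =
     (if x \<in> carrier S then INF n::nat. p (x \<oplus> n \<odot> z) - of_nat n * p z else p x)"

lemma additive_along_le:
  assumes "x \<in> carrier S" 
  shows "additive_along p z x \<le> p (x \<oplus> n \<odot> z) - of_nat n * p z"
  using assms by (auto simp: additive_along_def intro: INF_lower)

lemma additive_along_le_self:
  assumes "z \<in> carrier S"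
  shows "additive_along p z x \<le> p x"
  using additive_along_le[of x p z 0] assms by (cases "x \<in> carrier S") (auto simp: additive_along_def)

lemma additive_along_greatest:
  assumes "x \<in> carrier S" "\<And>n. a \<le> p (x \<oplus> n \<odot> z) - of_nat n * p z"
  shows "a \<le> additive_along p z x"
  using assms by (auto simp: additive_along_def intro!: INF_greatest)

text \<open>For subadditivity the indices n and m of two terms are merged into n + m. For multiples,
  k times the term of x with index n is at most the term of k x with index k n, and as terms
  decrease in the index, this is at most the term of k x with index n.\<close>

lemma sublinear_additive_along:
  assumes p: "sublinear S p" and z: "z \<in> carrier S" "p z < top"
  shows "sublinear S (additive_along p z)"
proof -
  let ?q = "additive_along p z"
  have fin: "of_nat n * p z < top" for n using z by (simp add: ennreal_mult_less_top of_nat_less_top)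
  show ?thesis
  proof (rule sublinearI)
    show "?q \<zero> = 0"
      using additive_along_le_self[OF z(1), of p \<zero>] by (simp add: sublinear_zero[OF p])
  next
    fix x y assume xy: "x \<in> carrier S" "y \<in> carrier S"
    have "?q (x \<oplus> y) \<le> (p (x \<oplus> n \<odot> z) - of_nat n * p z) + (p (y \<oplus> m \<odot> z) - of_nat m * p z)"
      for n m
    proof -
      have "x \<oplus> y \<oplus> (n + m) \<odot> z = (x \<oplus> n \<odot> z) \<oplus> (y \<oplus> m \<odot> z)"
        using xy z by (simp add: osg_mult_add_left osg.m_ac)
      then have "?q (x \<oplus> y) \<le> p ((x \<oplus> n \<odot> z) \<oplus> (y \<oplus> m \<odot> z)) - of_nat (n + m) * p z"
        using additive_along_le[of "x \<oplus> y" p z "n + m"] xy by simp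
      also have "\<dots> \<le> (p (x \<oplus> n \<odot> z) + p (y \<oplus> m \<odot> z)) - (of_nat n * p z + of_nat m * p z)"
        using xy z by (auto simp: distrib_right intro!: ennreal_minus_mono sublinear_add[OF p])
      also have "\<dots> \<le> (p (x \<oplus> n \<odot> z) - of_nat n * p z) + (p (y \<oplus> m \<odot> z) - of_nat m * p z)"
        by (intro ennreal_diff_add_diff_ge fin)
      finally show ?thesis .
    qed
    then have "?q (x \<oplus> y) \<le> (INF n::nat. p (x \<oplus> n \<odot> z) - of_nat n * p z) +
        (INF m::nat. p (y \<oplus> m \<odot> z) - of_nat m * p z)"
      by (intro INF_add_INF_le_ennreal) auto
    then show "?q (x \<oplus> y) \<le> ?q x + ?q y" using xy by (simp add: additive_along_def)
  next
    fix x y assume xy: "x \<in> carrier S" "y \<in> carrier S" "x \<sqsubseteq> y"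
    show "?q x \<le> ?q y"
    proof (rule additive_along_greatest)
      fix n
      have "?q x \<le> p (x \<oplus> n \<odot> z) - of_nat n * p z" using xy by (intro additive_along_le)
      also have "\<dots> \<le> p (y \<oplus> n \<odot> z) - of_nat n * p z"
        using xy z by (intro ennreal_minus_mono sublinear_mono[OF p] add_right_mono) auto
      finally show "?q x \<le> p (y \<oplus> n \<odot> z) - of_nat n * p z" .
    qed (use xy in auto)
  next
    fix k :: nat and x assume k: "0 < k" and x: "x \<in> carrier S"
    show "of_nat k * ?q x \<le> ?q (k \<odot> x)"
    proof (rule additive_along_greatest)
      fix n :: nat
      have "of_nat k * ?q x \<le> of_nat k * (p (x \<oplus> n \<odot> z) - of_nat n * p z)"
        using x by (intro mult_left_mono additive_along_le) auto
      also have "\<dots> \<le> of_nat k * p (x \<oplus> n \<odot> z) - of_nat (k * n) * p z"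
      proof -
        \<comment> \<open>Here n p z \<le> p (x + n z), so the truncated difference is a true one
          and can be multiplied by k termwise.\<close>
        have "p (x \<oplus> n \<odot> z) - of_nat n * p z + of_nat n * p z \<le> p (x \<oplus> n \<odot> z)"
        proof -
          have "of_nat n * p z = p (n \<odot> z)" using sublinear_mult[OF p z(1)] by simp
          also have "\<dots> \<le> p (x \<oplus> n \<odot> z)"
            using x z le_add[of "n \<odot> z" x] by (intro sublinear_mono[OF p]) (auto simp: osg.m_comm)
          finally show ?thesis by (simp add: diff_add_cancel_ennreal)
        qed
        then have "of_nat k * (p (x \<oplus> n \<odot> z) - of_nat n * p z + of_nat n * p z)
           \<le> of_nat k * p (x \<oplus> n \<odot> z)" by (rule mult_left_mono) auto
        then show ?thesis by (simp add: ennreal_le_minus_iff distrib_left mult.assoc)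
      qed
      also have "of_nat k * p (x \<oplus> n \<odot> z) = p (k \<odot> x \<oplus> (k * n) \<odot> z)"
        using x z by (simp add: sublinear_mult[OF p, symmetric] osg_mult_add_right osg_mult_mult)
      also have "p (k \<odot> x \<oplus> (k * n) \<odot> z) - of_nat (k * n) * p z \<le>
          p (k \<odot> x \<oplus> n \<odot> z) - of_nat n * p z"
        using x z k by (intro sublinear_sum_diff_antimono p) auto
      finally show "of_nat k * ?q x \<le> p (k \<odot> x \<oplus> n \<odot> z) - of_nat n * p z" .
    qed (use x in auto)
  qed
qed

text \<open>Zorn's lemma gives a minimal sublinear function among those below \<open>p0\<close> that
  keep the value at s. Minimality forces additivity in a direction z once
  \<open>additive_along p z\<close> still keeps the value at s. This is shown for z = s by
  homogeneity, and the resulting additivity along s then yields it for every z.\<close>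

theorem additive_below_sublinear:
  assumes p0: "sublinear S p0" and s: "s \<in> carrier S"
  obtains p where "sublinear S p" "\<And>x. p x \<le> p0 x" "p0 s \<le> p s"
    "\<And>x y. x \<in> carrier S \<Longrightarrow> y \<in> carrier S \<Longrightarrow> p (x \<oplus> y) = p x + p y"
proof -
  define A where "A = {p. sublinear S p \<and> p \<le> p0 \<and> p0 s \<le> p s}"
  have "\<exists>m\<in>A. \<forall>a\<in>A. m \<ge> a \<longrightarrow> a = m"
  proof (rule predicate_Zorn)
    show "partial_order_on A (relation_of (\<ge>) A)"
      by (rule partial_order_on_relation_ofI) auto
  next
    fix K assume K: "K \<in> Chains (relation_of (\<ge>) A)"
    have KA: "K \<subseteq> A" and total: "\<And>p q. p \<in> K \<Longrightarrow> q \<in> K \<Longrightarrow> p \<le> q \<or> q \<le> p"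
      using K by (auto simp: Chains_def relation_of_def)
    show "\<exists>u\<in>A. \<forall>a\<in>K. u \<le> a"
    proof (cases "K = {}")
      case True
      then show ?thesis using p0 by (auto simp: A_def)
    next
      case False
      define u where "u x = (INF p\<in>K. p x)" for x
      have K_sub: "sublinear S p" if "p \<in> K" for p using that KA by (auto simp: A_def)
      have u_le: "u x \<le> p x" if "p \<in> K" for p x using that by (auto simp: u_def intro: INF_lower)
      have "sublinear S u"
      proof (rule sublinearI)
        show "u \<zero> = 0" using False u_le sublinear_zero[OF K_sub] by (metis ex_in_conv le_zero_eq)
      next
        fix x y assume xy: "x \<in> carrier S" "y \<in> carrier S"
        have "u (x \<oplus> y) \<le> p x + q y" if pq: "p \<in> K" "q \<in> K" for p q
        proof -
          \<comment> \<open>Two members of a chain are comparable, so one function r bounds both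
            summands.\<close>
          obtain r where r: "r \<in> K" "r \<le> p" "r \<le> q" using total[OF pq] pq by auto
          have "u (x \<oplus> y) \<le> r (x \<oplus> y)" using r u_le by auto
          also have "\<dots> \<le> r x + r y" using K_sub r xy sublinear_add by auto
          also have "\<dots> \<le> p x + q y" using r by (intro add_mono) (auto simp: le_fun_def)
          finally show ?thesis .
        qed
        then show "u (x \<oplus> y) \<le> u x + u y"
          unfolding u_def[of x] u_def[of y] using False by (intro INF_add_INF_le_ennreal) auto
      next
        fix x y assume xy: "x \<in> carrier S" "y \<in> carrier S" "x \<sqsubseteq> y"
        then show "u x \<le> u y"
          unfolding u_def using K_sub sublinear_mono by (intro INF_mono) blast
      next
        fix n :: nat and x assume x: "x \<in> carrier S"
        have "of_nat n * u x \<le> p (n \<odot> x)" if "p \<in> K" for p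
        proof -
          have "of_nat n * u x \<le> of_nat n * p x" using u_le that by (intro mult_left_mono) auto
          also have "\<dots> \<le> p (n \<odot> x)" using K_sub that x sublinear_mult_ge by auto
          finally show ?thesis .
        qed
        then show "of_nat n * u x \<le> u (n \<odot> x)" 
          unfolding u_def[of "n \<odot> x"] by (intro INF_greatest) auto
      qed
      moreover have "u \<le> p0"
      proof -
        obtain p where p: "p \<in> K" "p \<le> p0" using False KA by (auto simp: A_def)
        have "u \<le> p" using u_le[OF p(1)] by (rule le_funI)
        then show ?thesis using p(2) by (rule order_trans)
      qed
      moreover have "p0 s \<le> u s" using KA by (auto simp: u_def A_def intro: INF_greatest)
      ultimately show ?thesis using u_le by (auto simp: A_def le_fun_def)
    qed
  qed
  then obtain p where p: "sublinear S p" "p \<le> p0" "p0 s \<le> p s"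
    and minimal: "\<And>q. sublinear S q \<Longrightarrow> q \<le> p0 \<Longrightarrow> p0 s \<le> q s \<Longrightarrow> q \<le> p \<Longrightarrow> q = p"
    by (auto simp: A_def)
  have p_add_ge: "p y \<le> p (x \<oplus> y)" if "x \<in> carrier S" "y \<in> carrier S" for x y
    using that le_add[of y x] by (intro sublinear_mono[OF p(1)]) (auto simp: osg.m_comm)
  \<comment> \<open>The hypothesis \<open>ge\<close> says that replacing p by
    \<open>additive_along p z\<close> stays inside the set that p minimizes. If p z is infinite,
    monotonicity makes both sides infinite.\<close>
  have additive: "p (x \<oplus> z) = p x + p z"
    if x: "x \<in> carrier S" and z: "z \<in> carrier S" and ge: "p z < top \<Longrightarrow> p0 s \<le> additive_along p z s" for x z
  proof (cases "p z < top")
    case True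
    \<comment> \<open>Minimality compares functions on the whole type; the default value of
      \<open>additive_along\<close> outside the carrier is p itself for this reason.\<close>
    have le: "additive_along p z \<le> p" using additive_along_le_self[OF z, of p] by (rule le_funI)
    have "additive_along p z = p"
      using True ge z p le order_trans[OF le p(2)] by (intro minimal sublinear_additive_along)
    then have "p x \<le> p (x \<oplus> z) - p z" using additive_along_le[OF x, of p z 1] z by auto
    then have "p x + p z \<le> p (x \<oplus> z)"
      using p_add_ge[OF x z] by (auto simp: ennreal_le_minus_iff)
    then show ?thesis using sublinear_add[OF p(1) x z] by simp
  next
    case False
    then have "p z = top" by (metis less_top)
    then show ?thesis using p_add_ge[OF x z] by (simp add: top_unique)
  qed
  \<comment> \<open>Along s each term of the infimum at s is (n + 1) p s - n p s, so the value at s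
    survives.\<close>
  have s_additive: "p (x \<oplus> s) = p x + p s" if x: "x \<in> carrier S" for x
  proof (rule additive)
    assume fin: "p s < top"
    have "p s \<le> additive_along p s s"
    proof (rule additive_along_greatest[OF s])
      fix n :: nat
      have "p (s \<oplus> n \<odot> s) = p (Suc n \<odot> s)" using s by (simp add: osg.m_comm)
      also have "\<dots> = of_nat (Suc n) * p s" by (rule sublinear_mult[OF p(1) s])
      finally show "p s \<le> p (s \<oplus> n \<odot> s) - of_nat n * p s"
        by (simp add: ennreal_le_minus_iff distrib_right)
    qed
    then show "p0 s \<le> additive_along p s s" using p by simp
  qed (use s x in auto)
  \<comment> \<open>Additivity along s, applied to n z, evaluates p (s + n z) exactly as p s + n p
    z, so no direction z lowers the value at s.\<close>
  have "p (x \<oplus> z) = p x + p z" if x: "x \<in> carrier S" and z: "z \<in> carrier S" for x z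
  proof (rule additive)
    assume fin: "p z < top"
    have "p s \<le> additive_along p z s"
    proof (rule additive_along_greatest[OF s])
      fix n :: nat
      have "p (s \<oplus> n \<odot> z) = p s + of_nat n * p z"
        using s_additive[of "n \<odot> z"] s z sublinear_mult[OF p(1) z, of n] by (simp add: osg.m_comm add.commute)
      then show "p s \<le> p (s \<oplus> n \<odot> z) - of_nat n * p z"
        by (simp add: ennreal_le_minus_iff)
    qed
    then show "p0 s \<le> additive_along p z s" using p by simp
  qed (use x z in auto)
  then show thesis using that[of p] p by (auto simp: le_fun_def)
qed

end

section \<open>Separation by functionals\<close>

lemma functionalsI:
  assumes "l \<in> extensional (carrier S)" "l \<zero>\<^bsub>S\<^esub> = 0"
    and "\<And>x y. x \<in> carrier S \<Longrightarrow> y \<in> carrier S \<Longrightarrow> l (x \<oplus>\<^bsub>S\<^esub> y) = l x + l y"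
    and "\<And>x y. x \<in> carrier S \<Longrightarrow> y \<in> carrier S \<Longrightarrow> x \<sqsubseteq>\<^bsub>S\<^esub> y \<Longrightarrow> l x \<le> l y"
    and "\<And>s x. increasing S s \<Longrightarrow> is_seq_sup S s x \<Longrightarrow> l x = (SUP n. l (s n))"
  shows "l \<in> functionals S"
  using assms by (auto simp: functionals_def)

lemma
  assumes "l \<in> functionals S"
  shows functionals_extensional: "l \<in> extensional (carrier S)"
    and functionals_zero: "l \<zero>\<^bsub>S\<^esub> = 0"
    and functionals_add: "x \<in> carrier S \<Longrightarrow> y \<in> carrier S \<Longrightarrow> l (x \<oplus>\<^bsub>S\<^esub> y) = l x + l y"
    and functionals_mono: "x \<in> carrier S \<Longrightarrow> y \<in> carrier S \<Longrightarrow> x \<sqsubseteq>\<^bsub>S\<^esub> y \<Longrightarrow> l x \<le> l y"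
    and functionals_sup: "increasing S s \<Longrightarrow> is_seq_sup S s x \<Longrightarrow> l x = (SUP n. l (s n))"
  using assms by (auto simp: functionals_def)

lemma increasing_carrier: "increasing S s \<Longrightarrow> s n \<in> carrier S"
  by (auto simp: increasing_def)

lemma is_seq_sup_carrier: "is_seq_sup S s x \<Longrightarrow> x \<in> carrier S"
  by (auto simp: is_seq_sup_def least_def Upper_def)

lemma is_seq_sup_upper: "increasing S s \<Longrightarrow> is_seq_sup S s x \<Longrightarrow> s n \<sqsubseteq>\<^bsub>S\<^esub> x"
  by (auto simp: is_seq_sup_def least_def Upper_def increasing_def)

lemma is_seq_supI:
  assumes "x \<in> carrier S" "\<And>n. s n \<in> carrier S" "\<And>n. s n \<sqsubseteq>\<^bsub>S\<^esub> x"
    and "\<And>y. y \<in> carrier S \<Longrightarrow> (\<And>n. s n \<sqsubseteq>\<^bsub>S\<^esub> y) \<Longrightarrow> x \<sqsubseteq>\<^bsub>S\<^esub> y"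
  shows "is_seq_sup S s x"
  using assms by (auto simp: is_seq_sup_def least_def Upper_def)

section \<open>Regularization and the separation theorem\<close>

definition regularization :: "'a osg \<Rightarrow> ('a \<Rightarrow> ennreal) \<Rightarrow> 'a \<Rightarrow> ennreal" where
  "regularization S p = (\<lambda>x\<in>carrier S. SUP x'\<in>{x' \<in> carrier S. way_below S x' x}. p x')"

context ordered_semigroup
begin

lemma increasing_le:
  assumes "increasing S s" "m \<le> n"
  shows "s m \<sqsubseteq> s n"
  using assms(2)
proof (induction n rule: dec_induct)
  case (step n)
  then show ?case
    using assms(1) le_trans[of "s m" "s n" "s (Suc n)"] by (auto simp: increasing_def)
qed (use assms(1) in \<open>auto simp: increasing_def\<close>)

lemma way_below_chain:
  assumes "axiom_O2 S" "x \<in> carrier S"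
  obtains s where "increasing S s" "is_seq_sup S s x"
    "\<forall>n. way_below S (s n) (s (Suc n))" "\<forall>n. way_below S (s n) x"
proof -
  obtain s where s: "\<And>n. s n \<in> carrier S" "\<And>n. way_below S (s n) (s (Suc n))" "is_seq_sup S s x"
    using assms unfolding axiom_O2_def by blast
  have inc: "increasing S s" using s way_below_imp_le by (auto simp: increasing_def)
  then have "way_below S (s n) x" for n
    using way_below_le_trans[OF s(2)[of n]] is_seq_sup_upper[OF inc s(3)] s assms by auto
  then show thesis using that[OF inc] s by blast
qed

lemma way_below_mult:
  assumes "axiom_O3 S" "x \<in> carrier S" "y \<in> carrier S" "way_below S x y"
  shows "way_below S (n \<odot> x) (n \<odot> y)"
  using assms by (induction n) (auto simp: zero_way_below axiom_O3_def)

lemma functionals_mult: "l \<in> functionals S \<Longrightarrow> x \<in> carrier S \<Longrightarrow> l (n \<odot> x) = of_nat n * l x"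
  by (induction n) (auto simp: functionals_zero functionals_add distrib_right add.commute)

end

text \<open>O5 is kept out of the locale so that the realification can be made an instance while O5
  is still being proved for it.\<close>

locale cu_semigroup = ordered_semigroup +
  assumes O1: "axiom_O1 S" and O2: "axiom_O2 S" and O3: "axiom_O3 S" and O4: "axiom_O4 S"
begin

lemma way_below_interpolation:
  assumes "x \<in> carrier S" "y \<in> carrier S" "way_below S x y"
  obtains z where "z \<in> carrier S" "way_below S x z" "way_below S z y"
  using way_below_interpolate[OF O2 assms] .

lemma regularization_ge:
  assumes "x \<in> carrier S" "x' \<in> carrier S" "way_below S x' x"
  shows "p x' \<le> regularization S p x"
  using assms by (auto simp: regularization_def intro: SUP_upper)

lemma regularization_least:
  assumes "x \<in> carrier S" "\<And>x'. x' \<in> carrier S \<Longrightarrow> way_below S x' x \<Longrightarrow> p x' \<le> a"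
  shows "regularization S p x \<le> a"
  using assms by (auto simp: regularization_def intro: SUP_least)

text \<open>Superadditivity comes from O3, which makes sums of way-below elements way below the sum.
  Subadditivity comes from O4: an element way below x + y lies below some
  \<open>s n \<oplus> t n\<close> of the approximating chains. Suprema are preserved because the
  way-below relation interpolates.\<close>

lemma regularization_in_functionals:
  assumes p: "sublinear S p"
    and add: "\<And>x y. x \<in> carrier S \<Longrightarrow> y \<in> carrier S \<Longrightarrow> p (x \<oplus> y) = p x + p y"
  shows "regularization S p \<in> functionals S"
proof (rule functionalsI)
  let ?r = "regularization S p"
  show "?r \<in> extensional (carrier S)" by (simp add: regularization_def)
  show "?r \<zero> = 0"
  proof -
    have "?r \<zero> \<le> p \<zero>"
      by (rule regularization_least) (auto intro: sublinear_mono[OF p] way_below_imp_le)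
    then show ?thesis using sublinear_zero[OF p] by simp
  qed
  show mono: "?r x \<le> ?r y" if xy: "x \<in> carrier S" "y \<in> carrier S" "x \<sqsubseteq> y" for x y
    using xy by (auto intro!: regularization_least regularization_ge way_below_le_trans[of _ x y])
  show "?r (x \<oplus> y) = ?r x + ?r y" if xy: "x \<in> carrier S" "y \<in> carrier S" for x y
  proof (rule antisym)
    obtain s where s: "increasing S s" "is_seq_sup S s x"
        "\<forall>n. way_below S (s n) (s (Suc n))" "\<forall>n. way_below S (s n) x"
      by (rule way_below_chain[OF O2 xy(1)])
    obtain t where t: "increasing S t" "is_seq_sup S t y" "\<forall>n. way_below S (t n) y"
      using way_below_chain[OF O2 xy(2)] by metis
    note st = increasing_carrier[OF s(1)] increasing_carrier[OF t(1)]
    have inc: "increasing S (\<lambda>n. s n \<oplus> t n)"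
      using s t st by (auto simp: increasing_def intro!: osg_add_mono)
    have sup: "is_seq_sup S (\<lambda>n. s n \<oplus> t n) (x \<oplus> y)" using O4 s t unfolding axiom_O4_def by blast
    show "?r (x \<oplus> y) \<le> ?r x + ?r y"
    proof (rule regularization_least)
      fix w assume w: "w \<in> carrier S" "way_below S w (x \<oplus> y)"
      then obtain n where "w \<sqsubseteq> s n \<oplus> t n" using inc sup xy unfolding way_below_def by blast
      then have "p w \<le> p (s n \<oplus> t n)" using w st by (intro sublinear_mono[OF p]) auto
      also have "\<dots> = p (s n) + p (t n)" using st by (intro add)
      also have "\<dots> \<le> ?r x + ?r y" using s t st xy by (intro add_mono regularization_ge) auto
      finally show "p w \<le> ?r x + ?r y" .
    qed (use xy in auto)
    \<comment> \<open>A supremum over the empty set would be 0 and could not be pulled out of a sum;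
      the zero element keeps the index sets nonempty.\<close>
    have ne: "{x' \<in> carrier S. way_below S x' z} \<noteq> {}" for z using zero_way_below by auto
    have le: "p x' + p y' \<le> ?r (x \<oplus> y)"
      if "x' \<in> carrier S" "y' \<in> carrier S" "way_below S x' x" "way_below S y' y" for x' y'
    proof -
      have "way_below S (x' \<oplus> y') (x \<oplus> y)" using that xy O3 unfolding axiom_O3_def by blast
      then have "p (x' \<oplus> y') \<le> ?r (x \<oplus> y)" using that xy by (intro regularization_ge) auto
      then show ?thesis using add that by simp
    qed
    have "?r x + p y' \<le> ?r (x \<oplus> y)" if y': "y' \<in> carrier S" "way_below S y' y" for y'
      using le y' xy ne
      by (subst regularization_def) (auto simp: ennreal_SUP_add_left[symmetric] intro!: SUP_least)
    then show "?r x + ?r y \<le> ?r (x \<oplus> y)"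
      using xy ne
      by (subst (2) regularization_def) (auto simp: ennreal_SUP_add_right intro!: SUP_least)
  qed
  fix s x assume s: "increasing S s" "is_seq_sup S s x"
  have x: "x \<in> carrier S" using s(2) by (rule is_seq_sup_carrier)
  show "?r x = (SUP n. ?r (s n))"
  proof (rule antisym)
    show "?r x \<le> (SUP n. ?r (s n))"
    proof (rule regularization_least[OF x])
      fix w assume w: "w \<in> carrier S" "way_below S w x"
      obtain v where v: "v \<in> carrier S" "way_below S w v" "way_below S v x"
        using way_below_interpolation w x by blast
      then obtain n where "v \<sqsubseteq> s n" using s x unfolding way_below_def by blast
      then have "way_below S w (s n)" using v w s way_below_le_trans increasing_carrier by blast
      then have "p w \<le> ?r (s n)" using w s by (intro regularization_ge) (auto simp: increasing_carrier)
      then show "p w \<le> (SUP n. ?r (s n))" by (rule SUP_upper2[OF UNIV_I])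
    qed
    show "(SUP n. ?r (s n)) \<le> ?r x"
      using s x by (intro SUP_least mono) (auto simp: is_seq_sup_upper increasing_carrier)
  qed
qed

text \<open>Regularizing may lower the value at \<open>s'\<close>, but at s it is still at least the
  old value at \<open>s'\<close>, because \<open>s'\<close> is way below s. Hence the bound is
  transferred from \<open>s'\<close> to s.\<close>

theorem functional_separation:
  assumes p: "sublinear S p" and s: "s' \<in> carrier S" "s \<in> carrier S" "way_below S s' s"
  obtains l where "l \<in> functionals S" "p s' \<le> l s" "\<And>x. x \<in> carrier S \<Longrightarrow> l x \<le> p x"
proof -
  obtain q where q: "sublinear S q" "\<And>x. q x \<le> p x" "p s' \<le> q s'"
    "\<And>x y. x \<in> carrier S \<Longrightarrow> y \<in> carrier S \<Longrightarrow> q (x \<oplus> y) = q x + q y"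
    using additive_below_sublinear[OF p s(1)] by blast
  show thesis
  proof
    show "regularization S q \<in> functionals S" using q by (intro regularization_in_functionals)
    have "q s' \<le> regularization S q s" using s by (intro regularization_ge)
    then show "p s' \<le> regularization S q s" using q by (meson order_trans)
    show "regularization S q x \<le> p x" if "x \<in> carrier S" for x
    proof (rule regularization_least[OF that])
      fix x' assume "x' \<in> carrier S" "way_below S x' x"
      then have "q x' \<le> q x" using that way_below_imp_le by (intro sublinear_mono[OF q(1)])
      then show "q x' \<le> p x" using q order_trans by blast
    qed
  qed
qed

text \<open>The test function p is the gauge of x relative to t, the infimum of N / M with M x below
  N t, so p t \<le> 1. If no pair with the wanted ratio existed, p would exceed 1 at
  \<open>s'\<close>, and a separating functional would satisfy l t \<le> p t \<le> 1 < p s' \<le> l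
  s, against the assumption. The bound M \<le> N later keeps a rescaled coefficient from
  growing.\<close>

lemma le_of_functionals_le:
  assumes s: "s' \<in> carrier S" "s \<in> carrier S" "way_below S s' s" and t: "t \<in> carrier S"
    and le: "\<And>l. l \<in> functionals S \<Longrightarrow> l s \<le> l t" and d: "d < (1::real)"
  obtains M N :: nat where "0 < M" "M \<le> N" "d * real N < real M" "M \<odot> s' \<sqsubseteq> N \<odot> t"
proof -
  note * = that
  define p where "p x = (INF (M, N)\<in>{(M, N). 0 < M \<and> M \<odot> x \<sqsubseteq> N \<odot> t}. ennreal (real N / real M))" for x
  have p_le: "p x \<le> ennreal (real N / real M)" if "0 < M" "M \<odot> x \<sqsubseteq> N \<odot> t" for x M N
    using that by (auto simp: p_def intro!: INF_lower2[of "(M, N)"])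
  have p_ge: "a \<le> p x" if "\<And>M N. 0 < M \<Longrightarrow> M \<odot> x \<sqsubseteq> N \<odot> t \<Longrightarrow> a \<le> ennreal (real N / real M)" for a x
    using that by (auto simp: p_def intro!: INF_greatest)
  have p_eq_top: "p x = top" if "{(M, N). 0 < M \<and> M \<odot> x \<sqsubseteq> N \<odot> t} = {}" for x
    by (simp add: p_def that)
  have p: "sublinear S p"
  proof (rule sublinearI)
    show "p \<zero> = 0" using p_le[of 1 \<zero> 0] by simp
  next
    fix x y assume xy: "x \<in> carrier S" "y \<in> carrier S"
    let ?I = "\<lambda>x. {(M, N). 0 < M \<and> M \<odot> x \<sqsubseteq> N \<odot> t}"
    show "p (x \<oplus> y) \<le> p x + p y"
    proof (cases "?I x = {} \<or> ?I y = {}")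
      case True
      then have "p x = top \<or> p y = top" using p_eq_top by blast
      then show ?thesis by auto
    next
      case False
      have "p (x \<oplus> y) \<le> ennreal (real N / real M) + ennreal (real N' / real M')"
        if MN: "0 < M" "M \<odot> x \<sqsubseteq> N \<odot> t" "0 < M'" "M' \<odot> y \<sqsubseteq> N' \<odot> t" for M N M' N'
      proof -
        have "(M' * M) \<odot> x \<sqsubseteq> (M' * N) \<odot> t" "(M * M') \<odot> y \<sqsubseteq> (M * N') \<odot> t"
          using MN xy t by (auto simp: osg_mult_mult intro!: osg_mult_mono)
        then have "(M * M') \<odot> (x \<oplus> y) \<sqsubseteq> (M' * N + M * N') \<odot> t"
          using xy t by (auto simp: osg_mult_add_right osg_mult_add_left mult.commute intro!: osg_add_mono)
        then have "p (x \<oplus> y) \<le> ennreal (real (M' * N + M * N') / real (M * M'))"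
          using MN by (intro p_le) auto
        also have "real (M' * N + M * N') / real (M * M') = real N / real M + real N' / real M'"
          using MN by (simp add: field_simps)
        finally show ?thesis by (simp add: ennreal_plus)
      qed
      then show ?thesis
        unfolding p_def[of x] p_def[of y] using False by (intro INF_add_INF_le_ennreal) auto
    qed
  next
    fix x y assume xy: "x \<in> carrier S" "y \<in> carrier S" "x \<sqsubseteq> y"
    show "p x \<le> p y"
    proof (rule p_ge)
      fix M N :: nat assume MN: "0 < M" "M \<odot> y \<sqsubseteq> N \<odot> t"
      have "M \<odot> x \<sqsubseteq> M \<odot> y" using xy by (intro osg_mult_mono)
      then have "M \<odot> x \<sqsubseteq> N \<odot> t"
        using MN xy t le_trans[of "M \<odot> x" "M \<odot> y" "N \<odot> t"] by auto
      then show "p x \<le> ennreal (real N / real M)" using MN by (intro p_le)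
    qed
  next
    fix n :: nat and x assume n: "0 < n" and x: "x \<in> carrier S"
    show "of_nat n * p x \<le> p (n \<odot> x)"
    proof (rule p_ge)
      fix M N :: nat assume MN: "0 < M" "M \<odot> (n \<odot> x) \<sqsubseteq> N \<odot> t"
      then have "p x \<le> ennreal (real N / real (M * n))"
        using x n by (intro p_le) (auto simp: osg_mult_mult)
      then have "of_nat n * p x \<le> of_nat n * ennreal (real N / real (M * n))"
        by (intro mult_left_mono) auto
      also have "\<dots> = ennreal (real n * (real N / real (M * n)))"
        by (subst ennreal_mult') (simp_all add: ennreal_of_nat_eq_real_of_nat)
      also have "real n * (real N / real (M * n)) = real N / real M" using n by simp
      finally show "of_nat n * p x \<le> ennreal (real N / real M)" .
    qed
  qed
  \<comment> \<open>The number d may be zero or negative; the maximum with 1/2 makes 1 / e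
    meaningful and keeps e < 1.\<close>
  define e where "e = max d (1 / 2)"
  have e: "0 < e" "e < 1" "d \<le> e" using d by (auto simp: e_def)
  show thesis
  proof (rule ccontr)
    assume contra: "\<not> thesis"
    have no: "real M \<le> e * real N" if "0 < M" "M \<odot> s' \<sqsubseteq> N \<odot> t" "M \<le> N" for M N
    proof (rule ccontr)
      assume "\<not> real M \<le> e * real N"
      moreover have "d * real N \<le> e * real N" using e by (intro mult_right_mono) auto
      ultimately show False using contra *[OF that(1,3) _ that(2)] by auto
    qed
    \<comment> \<open>Pairs with M > N reduce to the excluded case: N s' lies below M s', so (N, N)
      is admissible too, and N \<le> e N is impossible for positive N. If N = 0, then s' lies below
      zero and (1, 1) is admissible.\<close>
    have bound: "real M \<le> e * real N" if MN: "0 < M" "M \<odot> s' \<sqsubseteq> N \<odot> t" for M N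
    proof (cases "M \<le> N")
      case False
      have "N \<odot> s' \<sqsubseteq> M \<odot> s'" using False s by (intro osg_mult_mono_left) auto
      then have N: "N \<odot> s' \<sqsubseteq> N \<odot> t" using MN s t le_trans[of "N \<odot> s'" "M \<odot> s'" "N \<odot> t"] by auto
      show ?thesis
      proof (cases "N = 0")
        case True
        have "1 \<odot> s' \<sqsubseteq> M \<odot> s'" using MN s by (intro osg_mult_mono_left) auto
        moreover have "\<zero> \<sqsubseteq> t" using t by (rule zero_least)
        ultimately have "1 \<odot> s' \<sqsubseteq> 1 \<odot> t"
          using MN True s t le_trans[of s' "M \<odot> s'" \<zero>] le_trans[of s' \<zero> t] by simp
        then show ?thesis using no[of 1 1] e by simp
      next
        case False
        then have "real N \<le> e * real N" using N by (intro no) auto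
        then show ?thesis using False e by simp
      qed
    qed (use MN no in auto)
    obtain l where l: "l \<in> functionals S" "p s' \<le> l s" "\<And>x. x \<in> carrier S \<Longrightarrow> l x \<le> p x"
      using functional_separation[OF p s] by blast
    have "ennreal (1 / e) \<le> p s'"
    proof (rule p_ge)
      fix M N :: nat assume "0 < M" "M \<odot> s' \<sqsubseteq> N \<odot> t"
      then have "real M \<le> e * real N" by (rule bound)
      then show "ennreal (1 / e) \<le> ennreal (real N / real M)"
        using e \<open>0 < M\<close> by (intro ennreal_leI) (simp add: field_simps)
    qed
    also have "p s' \<le> l t" using l le[OF l(1)] by (meson order_trans)
    also have "l t \<le> p t" using l t by auto
    also have "p t \<le> ennreal (real 1 / real 1)" using t by (intro p_le) auto
    finally show False using e by (simp add: ennreal_le_1)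
  qed
qed

end

section \<open>The ordered semigroup structure of the realification\<close>

definition scaled_hat :: "'a osg \<Rightarrow> real \<Rightarrow> 'a \<Rightarrow> ('a \<Rightarrow> ennreal) \<Rightarrow> ennreal" where
  "scaled_hat S c x = (\<lambda>l\<in>functionals S. ennreal c * l x)"

lemma scaled_hat_apply [simp]: "l \<in> functionals S \<Longrightarrow> scaled_hat S c x l = ennreal c * l x"
  by (simp add: scaled_hat_def)

lemma realification_le_iff [simp]:
  "f \<sqsubseteq>\<^bsub>realification S\<^esub> g \<longleftrightarrow> (\<forall>l\<in>functionals S. f l \<le> g l)"
  by (simp add: realification_def)

lemma realification_add_apply [simp]:
  "l \<in> functionals S \<Longrightarrow> (f \<oplus>\<^bsub>realification S\<^esub> g) l = f l + g l"
  by (simp add: realification_def)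

lemma realification_zero_apply [simp]:
  "l \<in> functionals S \<Longrightarrow> \<zero>\<^bsub>realification S\<^esub> l = 0"
  by (simp add: realification_def)

lemma realification_extensional:
  "f \<in> carrier (realification S) \<Longrightarrow> f \<in> extensional (functionals S)"
  by (auto simp: realification_def Lsc_def)

lemma realification_eqI:
  assumes "f \<in> extensional (functionals S)" "g \<in> extensional (functionals S)"
    "\<And>l. l \<in> functionals S \<Longrightarrow> f l = g l"
  shows "f = g"
  using assms by (rule extensionalityI)

lemma increasing_realification_iff:
  "increasing (realification S) g \<longleftrightarrow> (\<forall>i. g i \<in> carrier (realification S)) \<and>
     (\<forall>i. \<forall>l\<in>functionals S. g i l \<le> g (Suc i) l)"
  by (simp add: increasing_def)

section \<open>Rational multiples and the form of the elements\<close>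

lemma pos_Rats_obtain:
  assumes "c \<in> \<rat>" "0 < c"
  obtains p q :: nat where "0 < q" "c = real p / real q"
  using Rats_abs_nat_div_natE[OF assms(1)] assms(2) by (metis abs_of_pos gr0I)

lemma increasing_incseq:
  assumes "increasing S s" "\<And>x y. x \<in> carrier S \<Longrightarrow> y \<in> carrier S \<Longrightarrow> x \<sqsubseteq>\<^bsub>S\<^esub> y \<Longrightarrow> l x \<le> l y"
  shows "incseq (\<lambda>n. l (s n))"
  using assms by (intro incseq_SucI) (auto simp: increasing_def)

text \<open>Positive rational coefficients replace the coefficients 1/n of the definition because
  they are visibly stable under sums, scaling and small decreases. Both forms describe the same
  functions, since (p/q) s is (1/q) times the element p s.\<close>

definition realification_rep ::
    "'a osg \<Rightarrow> (nat \<Rightarrow> real) \<Rightarrow> (nat \<Rightarrow> 'a) \<Rightarrow> (('a \<Rightarrow> ennreal) \<Rightarrow> ennreal) \<Rightarrow> bool" where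
  "realification_rep S c s f \<longleftrightarrow> f \<in> extensional (functionals S) \<and>
     (\<forall>i. c i \<in> \<rat> \<and> 0 < c i \<and> s i \<in> carrier S) \<and>
     (\<forall>i. \<forall>l\<in>functionals S. ennreal (c i) * l (s i) \<le> ennreal (c (Suc i)) * l (s (Suc i))) \<and>
     (\<forall>l\<in>functionals S. f l = (SUP i. ennreal (c i) * l (s i)))"

lemma realification_repI:
  assumes "f \<in> extensional (functionals S)" "\<And>i. c i \<in> \<rat>" "\<And>i. 0 < c i" "\<And>i. s i \<in> carrier S"
    and "\<And>i l. l \<in> functionals S \<Longrightarrow> ennreal (c i) * l (s i) \<le> ennreal (c (Suc i)) * l (s (Suc i))"
    and "\<And>l. l \<in> functionals S \<Longrightarrow> f l = (SUP i. ennreal (c i) * l (s i))"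
  shows "realification_rep S c s f"
  using assms by (simp add: realification_rep_def)

lemma
  assumes "realification_rep S c s f"
  shows realification_rep_extensional: "f \<in> extensional (functionals S)"
    and realification_rep_Rats: "c i \<in> \<rat>"
    and realification_rep_pos: "0 < c i"
    and realification_rep_carrier: "s i \<in> carrier S"
    and realification_rep_mono: "l \<in> functionals S \<Longrightarrow>
      ennreal (c i) * l (s i) \<le> ennreal (c (Suc i)) * l (s (Suc i))"
    and realification_rep_SUP: "l \<in> functionals S \<Longrightarrow> f l = (SUP i. ennreal (c i) * l (s i))"
  using assms by (simp_all add: realification_rep_def)

context ordered_semigroup
begin

lemma functional_add_in_functionals:
  assumes l: "l \<in> functionals S" and m: "m \<in> functionals S"
  shows "functional_add S l m \<in> functionals S"
proof (rule functionalsI)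
  fix s x assume s: "increasing S s" "is_seq_sup S s x"
  have "incseq (\<lambda>n. l (s n))" "incseq (\<lambda>n. m (s n))"
    using increasing_incseq[OF s(1)] functionals_mono[OF l] functionals_mono[OF m] by blast+
  then show "functional_add S l m x = (SUP n. functional_add S l m (s n))"
    using functionals_sup[OF l s] functionals_sup[OF m s] increasing_carrier[OF s(1)]
      is_seq_sup_carrier[OF s(2)] by (simp add: functional_add_def ennreal_SUP_add)
qed (use l m in \<open>auto simp: functional_add_def functionals_zero functionals_add ac_simps
       intro!: add_mono functionals_mono[OF l] functionals_mono[OF m]\<close>)

lemma functional_scale_in_functionals:
  assumes l: "l \<in> functionals S"
  shows "functional_scale S c l \<in> functionals S"
proof (rule functionalsI)
  fix s x assume s: "increasing S s" "is_seq_sup S s x"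
  show "functional_scale S c l x = (SUP n. functional_scale S c l (s n))"
    using functionals_sup[OF l s] increasing_carrier[OF s(1)]
      is_seq_sup_carrier[OF s(2)] by (simp add: functional_scale_def SUP_mult_left_ennreal)
qed (use l in \<open>auto simp: functional_scale_def functionals_zero functionals_add distrib_left
       intro!: mult_left_mono functionals_mono[OF l]\<close>)

lemma functional_zero_in_functionals: "functional_zero S \<in> functionals S"
  by (rule functionalsI) (auto simp: functional_zero_def increasing_carrier is_seq_sup_carrier)

lemma functional_open_greater:
  assumes x: "x \<in> carrier S" and c: "0 < c"
  shows "functional_open S {l \<in> functionals S. a < ennreal c * l x}"
  unfolding functional_open_def
proof (intro conjI ballI allI impI)
  fix k \<Psi> assume k: "k \<in> {l \<in> functionals S. a < ennreal c * l x}"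
    and conv: "functionals_converge S (\<lambda>m. m) k \<Psi>"
  have iff: "a < ennreal c * y \<longleftrightarrow> a / ennreal c < y" for y
    using c by (subst divide_less_ennreal) (auto simp: mult.commute)
  \<comment> \<open>Convergence bounds the limit inferior at x only for pairs of an element way
    below x and x; the pair of zero and x serves.\<close>
  have "k x \<le> Liminf \<Psi> (\<lambda>m. m x)" "eventually (\<lambda>m. m \<in> functionals S) \<Psi>"
    using conv x zero_way_below by (auto simp: functionals_converge_def)
  then show "eventually (\<lambda>m. m \<in> {l \<in> functionals S. a < ennreal c * l x}) \<Psi>"
    using k by (auto simp: le_Liminf_iff iff intro: eventually_conj)
qed auto

text \<open>Superlevel sets of a supremum are unions of superlevel sets, and a supremum of linear
  functions is additive because the sequence increases.\<close>

lemma realification_rep_in_Lsc: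
  assumes rep: "realification_rep S c s f"
  shows "f \<in> Lsc S"
proof -
  note f = realification_rep_extensional[OF rep] and c = realification_rep_pos[OF rep]
    and s = realification_rep_carrier[OF rep] and f_eq = realification_rep_SUP[OF rep]
  let ?F = "functionals S"
  have inc: "incseq (\<lambda>i. ennreal (c i) * l (s i))" if "l \<in> ?F" for l
    using realification_rep_mono[OF rep that] by (rule incseq_SucI)
  have "openin (functional_topology S) {l \<in> ?F. a < f l}" for a
  proof -
    have "{l \<in> ?F. a < f l} = (\<Union>i. {l \<in> ?F. a < ennreal (c i) * l (s i)})"
      by (auto simp: f_eq less_SUP_iff)
    then show ?thesis
      using functional_open_greater[OF s c] by (auto simp flip: openin_functional_topology)
  qed
  moreover have "f (functional_zero S) = 0"
    using s by (simp add: f_eq functional_zero_in_functionals) (simp add: functional_zero_def)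
  moreover have "f (functional_add S l m) = f l + f m" if "l \<in> ?F" "m \<in> ?F" for l m
    using that s inc
    by (simp add: f_eq functional_add_in_functionals ennreal_SUP_add[symmetric])
       (simp add: functional_add_def distrib_left)
  moreover have "f (functional_scale S a l) = ennreal a * f l" if "l \<in> ?F" for a l
    using that s
    by (simp add: f_eq functional_scale_in_functionals SUP_mult_left_ennreal)
       (simp add: functional_scale_def mult.left_commute)
  ultimately show ?thesis using f by (auto simp: Lsc_def)
qed

lemma hat_divide_of_nat:
  assumes "l \<in> functionals S" "0 < n"
  shows "hat S x l / of_nat n = ennreal (1 / real n) * l x"
  using assms
  by (simp add: hat_def divide_ennreal_def ennreal_of_nat_eq_real_of_nat inverse_ennreal
      inverse_eq_divide mult.commute)

lemma realification_rep_obtain: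
  assumes "f \<in> carrier (realification S)"
  obtains c s where "realification_rep S c s f"
proof -
  obtain s :: "nat \<Rightarrow> 'a" and n :: "nat \<Rightarrow> nat" where sn: "\<forall>i. s i \<in> carrier S \<and> 0 < n i"
    "\<forall>i. \<forall>l\<in>functionals S.
       hat S (s i) l / of_nat (n i) \<le> hat S (s (Suc i)) l / of_nat (n (Suc i))"
    "\<forall>l\<in>functionals S. f l = (SUP i. hat S (s i) l / of_nat (n i))"
    using assms unfolding realification_def by auto
  have "realification_rep S (\<lambda>i. 1 / real (n i)) s f"
    using sn realification_extensional[OF assms]
    by (intro realification_repI) (simp_all flip: hat_divide_of_nat)
  then show thesis by (rule that)
qed

lemma realification_rep_in_realification:
  assumes rep: "realification_rep S c s f"
  shows "f \<in> carrier (realification S)"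
proof -
  note s = realification_rep_carrier[OF rep]
  have "\<forall>i. \<exists>p q :: nat. 0 < q \<and> c i = real p / real q"
    using realification_rep_Rats[OF rep] realification_rep_pos[OF rep] pos_Rats_obtain by metis
  then obtain p q :: "nat \<Rightarrow> nat" where pq: "\<And>i. 0 < q i" "\<And>i. c i = real (p i) / real (q i)"
    by metis
  have eq: "hat S (p i \<odot> s i) l / of_nat (q i) = ennreal (c i) * l (s i)" if l: "l \<in> functionals S" for i l
  proof -
    have "hat S (p i \<odot> s i) l / of_nat (q i) = ennreal (1 / real (q i)) * (of_nat (p i) * l (s i))"
      using pq s l by (simp add: hat_divide_of_nat functionals_mult)
    also have "\<dots> = ennreal (1 / real (q i) * real (p i)) * l (s i)"
      by (subst ennreal_mult) (auto simp: ennreal_of_nat_eq_real_of_nat mult.assoc)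
    finally show ?thesis by (simp add: pq)
  qed
  have "\<exists>(t :: nat \<Rightarrow> 'a) n. (\<forall>i. t i \<in> carrier S \<and> 0 < n i) \<and>
      (\<forall>i. \<forall>l\<in>functionals S. hat S (t i) l / of_nat (n i) \<le> hat S (t (Suc i)) l / of_nat (n (Suc i))) \<and>
      (\<forall>l\<in>functionals S. f l = (SUP i. hat S (t i) l / of_nat (n i)))"
    using pq(1) s realification_rep_mono[OF rep] realification_rep_SUP[OF rep]
    by (intro exI[of _ "\<lambda>i. p i \<odot> s i"] exI[of _ q]) (simp add: eq)
  then show ?thesis
    using realification_rep_in_Lsc[OF rep] by (simp add: realification_def)
qed

lemma scaled_hat_in_realification:
  assumes "c \<in> \<rat>" "0 < c" "x \<in> carrier S"
  shows "scaled_hat S c x \<in> carrier (realification S)"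
  using assms
  by (intro realification_rep_in_realification[where c = "\<lambda>_. c" and s = "\<lambda>_. x"] realification_repI)
    (auto simp: scaled_hat_def)

lemma zero_in_realification: "\<zero>\<^bsub>realification S\<^esub> \<in> carrier (realification S)"
proof -
  have "\<zero>\<^bsub>realification S\<^esub> = scaled_hat S 1 \<zero>"
    by (auto simp: scaled_hat_def realification_def functionals_zero)
  then show ?thesis using scaled_hat_in_realification[of 1 \<zero>] by simp
qed

text \<open>Over a common denominator both numerators become elements of \<open>S\<close> and can be
  added there.\<close>

lemma scaled_hat_add:
  assumes "c \<in> \<rat>" "0 < c" "x \<in> carrier S" "d \<in> \<rat>" "0 < d" "y \<in> carrier S"
  shows "\<exists>e z. e \<in> \<rat> \<and> 0 < e \<and> z \<in> carrier S \<and> (\<forall>l\<in>functionals S.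
    ennreal c * l x + ennreal d * l y = ennreal e * l z)"
proof -
  obtain p q :: nat where pq: "0 < q" "c = real p / real q" using pos_Rats_obtain assms by blast
  obtain p' q' :: nat where pq': "0 < q'" "d = real p' / real q'" using pos_Rats_obtain assms by blast
  let ?e = "1 / (real q * real q')" and ?z = "(p * q') \<odot> x \<oplus> (p' * q) \<odot> y"
  have "ennreal c * l x + ennreal d * l y = ennreal ?e * l ?z" if l: "l \<in> functionals S" for l
  proof -
    have "ennreal c = ennreal ?e * ennreal (real (p * q'))" "ennreal d = ennreal ?e * ennreal (real (p' * q))"
      using pq pq' by (simp_all flip: ennreal_mult)
    then show ?thesis
      using l assms by (simp add: functionals_add functionals_mult ennreal_of_nat_eq_real_of_nat
          distrib_left mult.assoc del: of_nat_mult)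
  qed
  then show ?thesis using pq pq' assms by (intro exI[of _ ?e] conjI exI[of _ ?z]) auto
qed

lemma add_in_realification:
  assumes f: "f \<in> carrier (realification S)" and g: "g \<in> carrier (realification S)"
  shows "f \<oplus>\<^bsub>realification S\<^esub> g \<in> carrier (realification S)"
proof -
  obtain c s where c_rep: "realification_rep S c s f"
    using f by (rule realification_rep_obtain)
  note c = realification_rep_Rats[OF c_rep] realification_rep_pos[OF c_rep]
      realification_rep_carrier[OF c_rep]
    and c_mono = realification_rep_mono[OF c_rep] and f_eq = realification_rep_SUP[OF c_rep]
  obtain d t where d_rep: "realification_rep S d t g"
    using g by (rule realification_rep_obtain)
  note d = realification_rep_Rats[OF d_rep] realification_rep_pos[OF d_rep]
      realification_rep_carrier[OF d_rep]
    and d_mono = realification_rep_mono[OF d_rep] and g_eq = realification_rep_SUP[OF d_rep]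
  have "\<forall>i. \<exists>e z. e \<in> \<rat> \<and> 0 < e \<and> z \<in> carrier S \<and> (\<forall>l\<in>functionals S.
    ennreal (c i) * l (s i) + ennreal (d i) * l (t i) = ennreal e * l z)"
    by (intro allI scaled_hat_add c d)
  then obtain e z where e: "\<And>i. e i \<in> \<rat>" "\<And>i. 0 < e i" "\<And>i. z i \<in> carrier S"
    "\<And>i l. l \<in> functionals S \<Longrightarrow> ennreal (e i) * l (z i) = ennreal (c i) * l (s i) + ennreal (d i) * l (t i)"
    by metis
  show ?thesis
  proof (rule realification_rep_in_realification[where c = e and s = z], rule realification_repI)
    fix l assume l: "l \<in> functionals S"
    have "incseq (\<lambda>i. ennreal (c i) * l (s i))" "incseq (\<lambda>i. ennreal (d i) * l (t i))"
      using c_mono d_mono l by (auto intro: incseq_SucI)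
    then show "(f \<oplus>\<^bsub>realification S\<^esub> g) l = (SUP i. ennreal (e i) * l (z i))"
      using l by (simp add: e f_eq g_eq ennreal_SUP_add)
  qed (use e c_mono d_mono in \<open>auto simp: realification_def intro: add_mono\<close>)
qed

lemma scale_in_realification:
  assumes f: "f \<in> carrier (realification S)" and a: "a \<in> \<rat>" "0 < a"
  shows "(\<lambda>l\<in>functionals S. ennreal a * f l) \<in> carrier (realification S)"
proof -
  obtain c s where c_rep: "realification_rep S c s f"
    using f by (rule realification_rep_obtain)
  note c = realification_rep_Rats[OF c_rep] realification_rep_pos[OF c_rep]
      realification_rep_carrier[OF c_rep]
    and c_mono = realification_rep_mono[OF c_rep] and f_eq = realification_rep_SUP[OF c_rep]
  have eq: "ennreal (a * c i) * y = ennreal a * (ennreal (c i) * y)" for i y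
    using a c(2)[of i] by (simp add: ennreal_mult mult.assoc)
  show ?thesis
    by (rule realification_rep_in_realification[where c = "\<lambda>i. a * c i" and s = s],
      rule realification_repI)
      (use a c c_mono in \<open>auto simp: f_eq eq SUP_mult_left_ennreal intro!: mult_left_mono\<close>)
qed

lemma ordered_semigroup_realification: "ordered_semigroup (realification S)"
proof -
  let ?R = "realification S"
  have eq: "eq ?R = (=)" by (simp add: realification_def)
  have ext: "f \<oplus>\<^bsub>?R\<^esub> g \<in> extensional (functionals S)" for f g by (simp add: realification_def)
  have "partial_order ?R"
  proof (unfold_locales, simp_all add: eq)
    fix x y :: "('a \<Rightarrow> ennreal) \<Rightarrow> ennreal"
    assume "x \<in> carrier ?R" "y \<in> carrier ?R" "\<forall>l\<in>functionals S. x l \<le> y l"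
      "\<forall>l\<in>functionals S. y l \<le> x l"
    then show "x = y"
      by (intro realification_eqI[OF realification_extensional realification_extensional] antisym) auto
  next
    fix x y z :: "('a \<Rightarrow> ennreal) \<Rightarrow> ennreal" assume xy: "\<forall>l\<in>functionals S. x l \<le> y l"
      and yz: "\<forall>l\<in>functionals S. y l \<le> z l"
    show "\<forall>l\<in>functionals S. x l \<le> z l"
    proof
      fix l assume "l \<in> functionals S"
      then show "x l \<le> z l" using order_trans[of "x l" "y l" "z l"] xy yz by simp
    qed
  qed
  moreover have "comm_monoid (osg_monoid ?R)"
  proof (rule comm_monoidI)
    fix x y z assume "x \<in> carrier (osg_monoid ?R)" "y \<in> carrier (osg_monoid ?R)"
      "z \<in> carrier (osg_monoid ?R)"
    show "x \<otimes>\<^bsub>osg_monoid ?R\<^esub> y \<otimes>\<^bsub>osg_monoid ?R\<^esub> z =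
        x \<otimes>\<^bsub>osg_monoid ?R\<^esub> (y \<otimes>\<^bsub>osg_monoid ?R\<^esub> z)"
      by (rule realification_eqI[of _ S]) (auto simp: osg_monoid_def ext add.assoc)
  next
    fix x y assume xy: "x \<in> carrier (osg_monoid ?R)" "y \<in> carrier (osg_monoid ?R)"
    show "x \<otimes>\<^bsub>osg_monoid ?R\<^esub> y \<in> carrier (osg_monoid ?R)"
      using xy by (simp add: osg_monoid_def add_in_realification)
    show "x \<otimes>\<^bsub>osg_monoid ?R\<^esub> y = y \<otimes>\<^bsub>osg_monoid ?R\<^esub> x"
      by (rule realification_eqI[of _ S]) (auto simp: osg_monoid_def ext add.commute)
  next
    fix x assume x: "x \<in> carrier (osg_monoid ?R)"
    show "\<one>\<^bsub>osg_monoid ?R\<^esub> \<otimes>\<^bsub>osg_monoid ?R\<^esub> x = x"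
      using x by (intro realification_eqI[of _ S]) (auto simp: osg_monoid_def ext realification_extensional)
  qed (simp add: osg_monoid_def zero_in_realification)
  ultimately show ?thesis
    by (simp add: ordered_semigroup_def ordered_semigroup_axioms_def add_mono)
qed

end

text \<open>The way-below relation of the realification, with its suprema taken pointwise; it agrees with
  \<^const>\<open>way_below\<close> once pointwise suprema are known to stay in the realification.\<close>

definition pointwise_way_below ::
    "'a osg \<Rightarrow> (('a \<Rightarrow> ennreal) \<Rightarrow> ennreal) \<Rightarrow> (('a \<Rightarrow> ennreal) \<Rightarrow> ennreal) \<Rightarrow> bool" where
  "pointwise_way_below S x y \<longleftrightarrow> (\<forall>g. increasing (realification S) g \<and>
     (\<forall>l\<in>functionals S. y l \<le> (SUP i. g i l)) \<longrightarrow> (\<exists>i. x \<sqsubseteq>\<^bsub>realification S\<^esub> g i))"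

lemma pointwise_way_below_mono:
  assumes "x \<sqsubseteq>\<^bsub>realification S\<^esub> x'" "pointwise_way_below S x' y'" "y' \<sqsubseteq>\<^bsub>realification S\<^esub> y"
  shows "pointwise_way_below S x y"
  unfolding pointwise_way_below_def
proof (intro allI impI)
  fix g assume g: "increasing (realification S) g \<and> (\<forall>l\<in>functionals S. y l \<le> (SUP i. g i l))"
  then have "\<forall>l\<in>functionals S. y' l \<le> (SUP i. g i l)" using assms(3) order_trans by fastforce
  then obtain i where "x' \<sqsubseteq>\<^bsub>realification S\<^esub> g i"
    using g assms(2) unfolding pointwise_way_below_def by blast
  then have "x \<sqsubseteq>\<^bsub>realification S\<^esub> g i" using assms(1) order_trans by fastforce
  then show "\<exists>i. x \<sqsubseteq>\<^bsub>realification S\<^esub> g i" by blast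
qed

lemma pointwise_way_below_imp_le:
  assumes "y \<in> carrier (realification S)" "pointwise_way_below S x y"
  shows "x \<sqsubseteq>\<^bsub>realification S\<^esub> y"
  using assms(2)[unfolded pointwise_way_below_def, rule_format, of "\<lambda>_. y"] assms(1)
  by (simp add: increasing_realification_iff)

context cu_semigroup
begin

text \<open>The gauge p of x is the infimum of all a with x \<le> a \<open>g i\<close> pointwise for
  some i. If no \<open>g i\<close> dominates c s', then p s' \<ge> 1/c. A separating functional l
  below p has l s \<ge> 1/c, while each \<open>g i\<close> takes a value at most 1 at l. The assumed
  inequality at l reads d/c \<le> 1, contrary to c < d.\<close>

lemma pointwise_way_below_scaled_hat:
  assumes s: "s' \<in> carrier S" "s \<in> carrier S" "way_below S s' s" and c: "0 < c" "c < d"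
  shows "pointwise_way_below S (scaled_hat S c s') (scaled_hat S d s)"
  unfolding pointwise_way_below_def
proof (intro allI impI, elim conjE, rule ccontr)
  let ?F = "functionals S"
  fix g assume g: "increasing (realification S) g"
    and le: "\<forall>l\<in>?F. scaled_hat S d s l \<le> (SUP i. g i l)"
    and contra: "\<nexists>i. scaled_hat S c s' \<sqsubseteq>\<^bsub>realification S\<^esub> g i"
  have g_mono: "g i l \<le> g j l" if "i \<le> j" "l \<in> ?F" for i j l
    using that g lift_Suc_mono_le[of "\<lambda>i. g i l" i j] by (auto simp: increasing_realification_iff)
  define p where "p x = Inf {a. \<exists>i. \<forall>l\<in>?F. l x \<le> a * g i l}" for x
  have p_le: "p x \<le> a" if "\<And>l. l \<in> ?F \<Longrightarrow> l x \<le> a * g i l" for x a i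
    using that by (auto simp: p_def intro!: Inf_lower)
  have p_ge: "b \<le> p x" if "\<And>a i. (\<And>l. l \<in> ?F \<Longrightarrow> l x \<le> a * g i l) \<Longrightarrow> b \<le> a" for x b
    using that by (auto simp: p_def intro!: Inf_greatest)
  have p: "sublinear S p"
  proof (rule sublinearI)
    show "p \<zero> = 0" using p_le[of \<zero> 0] by (simp add: functionals_zero)
  next
    fix x y assume xy: "x \<in> carrier S" "y \<in> carrier S"
    let ?A = "\<lambda>x. {a. \<exists>i. \<forall>l\<in>?F. l x \<le> a * g i l}"
    show "p (x \<oplus> y) \<le> p x + p y"
    proof (cases "?A x = {} \<or> ?A y = {}")
      case True
      have "p z = top" if "?A z = {}" for z unfolding p_def that by simp
      then have "p x = top \<or> p y = top" using True by blast
      then show ?thesis by auto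
    next
      case False
      have "p (x \<oplus> y) \<le> a + b"
        if a: "\<forall>l\<in>?F. l x \<le> a * g i l" and b: "\<forall>l\<in>?F. l y \<le> b * g j l" for a b i j
      proof (rule p_le[of _ _ "max i j"])
        fix l assume l: "l \<in> ?F"
        have "l x \<le> a * g (max i j) l"
          using a l g_mono[of i "max i j" l] by (meson max.cobounded1 mult_left_mono order_trans zero_le)
        moreover have "l y \<le> b * g (max i j) l"
          using b l g_mono[of j "max i j" l] by (meson max.cobounded2 mult_left_mono order_trans zero_le)
        ultimately show "l (x \<oplus> y) \<le> (a + b) * g (max i j) l"
          using l xy by (simp add: functionals_add distrib_right add_mono)
      qed
      then have "p (x \<oplus> y) \<le> (INF a\<in>?A x. a) + (INF b\<in>?A y. b)"
        using False by (intro INF_add_INF_le_ennreal) auto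
      then show ?thesis by (simp add: p_def)
    qed
  next
    fix x y assume xy: "x \<in> carrier S" "y \<in> carrier S" "x \<sqsubseteq> y"
    show "p x \<le> p y"
    proof (rule p_ge)
      fix a i assume "\<And>l. l \<in> ?F \<Longrightarrow> l y \<le> a * g i l"
      then show "p x \<le> a" using functionals_mono[OF _ xy] by (intro p_le[of x a i]) (blast intro: order_trans)
    qed
  next
    fix n :: nat and x assume n: "0 < n" and x: "x \<in> carrier S"
    have cancel: "of_nat n * (ennreal (1 / real n) * a) = a" for a
    proof -
      have "of_nat n * (ennreal (1 / real n) * a) = ennreal (real n * (1 / real n)) * a"
        by (subst ennreal_mult) (auto simp: ennreal_of_nat_eq_real_of_nat mult.assoc)
      then show ?thesis using n by simp
    qed
    show "of_nat n * p x \<le> p (n \<odot> x)"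
    proof (rule p_ge)
      fix a i assume a: "\<And>l. l \<in> ?F \<Longrightarrow> l (n \<odot> x) \<le> a * g i l"
      have "p x \<le> ennreal (1 / real n) * a"
      proof (rule p_le)
        fix l assume l: "l \<in> ?F"
        have "l x = ennreal (1 / real n) * (of_nat n * l x)" 
          using cancel[of "l x"] by (simp add: mult.left_commute)
        also have "\<dots> \<le> ennreal (1 / real n) * (a * g i l)"
          using a[OF l] x l by (intro mult_left_mono) (auto simp: functionals_mult)
        finally show "l x \<le> ennreal (1 / real n) * a * g i l" by (simp add: mult.assoc)
      qed
      then have "of_nat n * p x \<le> of_nat n * (ennreal (1 / real n) * a)"
        by (rule mult_left_mono) auto
      then show "of_nat n * p x \<le> a" by (simp add: cancel)
    qed
  qed
  obtain l where l: "l \<in> ?F" "p s' \<le> l s" "\<And>x. x \<in> carrier S \<Longrightarrow> l x \<le> p x"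
    using functional_separation[OF p s] by blast
  have "ennreal (1 / c) \<le> p s'"
  proof (rule p_ge, rule ccontr)
    fix a i assume a: "\<And>l. l \<in> ?F \<Longrightarrow> l s' \<le> a * g i l" and "\<not> ennreal (1 / c) \<le> a"
    then have "ennreal c * a \<le> ennreal c * ennreal (1 / c)" by (intro mult_left_mono) auto
    also have "\<dots> = 1" using c by (simp flip: ennreal_mult)
    finally have ca: "ennreal c * a \<le> 1" .
    have "ennreal c * l s' \<le> g i l" if "l \<in> ?F" for l
    proof -
      have "ennreal c * l s' \<le> ennreal c * (a * g i l)" using a[OF that] by (rule mult_left_mono) auto
      also have "\<dots> = (ennreal c * a) * g i l" by (simp add: mult.assoc)
      also have "\<dots> \<le> 1 * g i l" using ca by (rule mult_right_mono) auto
      finally show ?thesis by simp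
    qed
    then show False using contra by auto
  qed
  then have "ennreal d * ennreal (1 / c) \<le> ennreal d * l s"
    using l by (intro mult_left_mono) auto
  also have "ennreal d * l s \<le> (SUP i. g i l)" using le l by auto
  \<comment> \<open>The bound l \<le> p concerns elements of \<open>S\<close>. It reaches
    \<open>g i\<close> through its representation: each term \<open>e j\<close> times
    \<open>t j\<close> is below \<open>g i\<close>, so the gauge of \<open>t j\<close> is at most 1
    / \<open>e j\<close>.\<close>
  also have "(SUP i. g i l) \<le> 1"
  proof (rule SUP_least)
    fix i
    have "g i \<in> carrier (realification S)" using g by (auto simp: increasing_realification_iff)
    then obtain e t where rep: "realification_rep S e t (g i)" by (rule realification_rep_obtain)
    note e = realification_rep_pos[OF rep] and t = realification_rep_carrier[OF rep]
      and eq = realification_rep_SUP[OF rep]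
    have "ennreal (e j) * l (t j) \<le> 1" for j
    proof -
      have e_inv: "ennreal (1 / e j) * ennreal (e j) = 1" "ennreal (e j) * ennreal (1 / e j) = 1"
        using e[of j] by (simp_all flip: ennreal_mult)
      have "l (t j) \<le> p (t j)" using l t by auto
      also have "\<dots> \<le> ennreal (1 / e j)"
      proof (rule p_le)
        fix m assume m: "m \<in> ?F"
        have "m (t j) = ennreal (1 / e j) * (ennreal (e j) * m (t j))"
          using e_inv by (simp add: mult.assoc[symmetric])
        also have "\<dots> \<le> ennreal (1 / e j) * g i m"
          unfolding eq[OF m] by (intro mult_left_mono SUP_upper) auto
        finally show "m (t j) \<le> ennreal (1 / e j) * g i m" .
      qed
      finally have "ennreal (e j) * l (t j) \<le> ennreal (e j) * ennreal (1 / e j)"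
        by (rule mult_left_mono) auto
      then show ?thesis using e_inv by simp
    qed
    then show "g i l \<le> 1" unfolding eq[OF l(1)] by (intro SUP_least)
  qed
  finally have "ennreal d * ennreal (1 / c) \<le> 1" .
  moreover have "ennreal (d * (1 / c)) = ennreal d * ennreal (1 / c)"
    using c by (intro ennreal_mult) auto
  ultimately have "ennreal (d * (1 / c)) \<le> 1" by simp
  then show False using c by (simp add: ennreal_le_1 field_simps)
qed

end

section \<open>Suprema and the way-below relation in the realification\<close>

text \<open>These rational factors increase strictly to 1 without reaching it. They provide the
  strict gaps between coefficients that way-below pairs require, and the shrinking factor used for
  O5.\<close>

lemma SUP_Suc_over_Suc_Suc: "(SUP j. ennreal (real (Suc j) / real (Suc (Suc j)))) = 1"
proof (rule LIMSEQ_unique)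
  have "incseq (\<lambda>j. real (Suc j) / real (Suc (Suc j)))"
    by (intro incseq_SucI) (simp add: field_simps)
  then show "(\<lambda>j. ennreal (real (Suc j) / real (Suc (Suc j)))) \<longlonglongrightarrow>
      (SUP j. ennreal (real (Suc j) / real (Suc (Suc j))))"
    by (intro LIMSEQ_SUP) (auto simp: incseq_def intro!: ennreal_leI)
  show "(\<lambda>j. ennreal (real (Suc j) / real (Suc (Suc j)))) \<longlonglongrightarrow> 1"
    using tendsto_ennrealI[OF LIMSEQ_Suc[OF LIMSEQ_n_over_Suc_n]] by simp
qed

context cu_semigroup
begin

text \<open>A row member is eventually way below the members of any later row, since that row has at
  least as large a supremum. So the column in row n can be chosen both to continue a way-below chain
  and to dominate the entries in column n of all rows up to n; the latter makes the diagonal reach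
  the full supremum. It serves to refine one representation and to form suprema of
  sequences.\<close>

lemma realification_diagonal:
  assumes x: "\<And>i j. x i j \<in> carrier (realification S)"
    and wb: "\<And>i j. pointwise_way_below S (x i j) (x i (Suc j))"
    and f: "\<And>i l. l \<in> functionals S \<Longrightarrow> f i l = (SUP j. x i j l)"
    and f_mono: "\<And>i l. l \<in> functionals S \<Longrightarrow> f i l \<le> f (Suc i) l"
  shows "\<exists>k. (\<forall>n. pointwise_way_below S (x n (k n)) (x (Suc n) (k (Suc n)))) \<and>
    (\<forall>l\<in>functionals S. (SUP n. x n (k n) l) = (SUP i. f i l))"
proof -
  let ?F = "functionals S" and ?R = "realification S"
  have x_inc: "increasing ?R (x i)" for i
    using x pointwise_way_below_imp_le[OF x wb] by (auto simp: increasing_realification_iff)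
  have x_mono: "x i j l \<le> x i j' l" if "l \<in> ?F" "j \<le> j'" for i j j' l
    using that x_inc[of i] lift_Suc_mono_le[of "\<lambda>j. x i j l" j j']
    by (auto simp: increasing_realification_iff)
  have f_le: "f i l \<le> f m l" if "i \<le> m" "l \<in> ?F" for i m l
    using that f_mono lift_Suc_mono_le[of "\<lambda>i. f i l" i m] by auto
  have ev: "\<forall>\<^sub>F K in sequentially. pointwise_way_below S (x i j) (x m K)" if "i \<le> m" for i j m
  proof -
    \<comment> \<open>Two spare columns are used: the step from j + 2 to j + 1 turns the pointwise
      bound into domination by one member of row m, the step from j + 1 to j makes that domination
      way below.\<close>
    have "x i (Suc (Suc j)) l \<le> (SUP p. x m p l)" if l: "l \<in> ?F" for l
    proof -
      have "x i (Suc (Suc j)) l \<le> f i l" unfolding f[OF l] by (rule SUP_upper) simp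
      also have "\<dots> \<le> f m l" using \<open>i \<le> m\<close> l by (rule f_le)
      finally show ?thesis by (simp add: f[OF l])
    qed
    then obtain p where p: "x i (Suc j) \<sqsubseteq>\<^bsub>?R\<^esub> x m p"
      using wb[of i "Suc j"] x_inc[of m] unfolding pointwise_way_below_def by blast
    show ?thesis
      unfolding eventually_sequentially
    proof (intro exI allI impI)
      fix K assume "p \<le> K"
      then have "x i (Suc j) \<sqsubseteq>\<^bsub>?R\<^esub> x m K"
        using p x_mono[OF _ \<open>p \<le> K\<close>, of _ m] by (auto intro: order_trans[of _ "x m p _"])
      then show "pointwise_way_below S (x i j) (x m K)"
        by (intro pointwise_way_below_mono[OF _ wb]) auto
    qed
  qed
  define P where "P n K \<longleftrightarrow> (\<forall>i\<le>n. x i n \<sqsubseteq>\<^bsub>?R\<^esub> x n K)" for n K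
  have ev_P: "\<forall>\<^sub>F K in sequentially. P n K" for n
  proof -
    have "\<forall>\<^sub>F K in sequentially. \<forall>i\<in>{..n}. pointwise_way_below S (x i n) (x n K)"
      using ev by (intro eventually_ball_finite) auto
    then show ?thesis
      by (rule eventually_mono) (use pointwise_way_below_imp_le[OF x] in \<open>auto simp: P_def\<close>)
  qed
  have "\<exists>k. \<forall>n. P n (k n) \<and> pointwise_way_below S (x n (k n)) (x (Suc n) (k (Suc n)))"
  proof (rule dependent_nat_choice)
    show "\<exists>K. P 0 K" using eventually_happens[OF ev_P] by simp
    show "\<exists>K'. P (Suc n) K' \<and> pointwise_way_below S (x n K) (x (Suc n) K')" for K n
      using eventually_happens[OF eventually_conj[OF ev_P ev[of n "Suc n" K]]] by simp
  qed
  then obtain k where k: "\<And>n. P n (k n)"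
    "\<And>n. pointwise_way_below S (x n (k n)) (x (Suc n) (k (Suc n)))" by blast
  have "(SUP n. x n (k n) l) = (SUP i. f i l)" if l: "l \<in> ?F" for l
  proof (rule antisym)
    have "x n (k n) l \<le> f n l" for n unfolding f[OF l] by (rule SUP_upper) simp
    then show "(SUP n. x n (k n) l) \<le> (SUP i. f i l)" by (intro SUP_mono) auto
    \<comment> \<open>Moving to column max i j first puts the entry under the control of
      \<open>P\<close> for row max i j.\<close>
    have "x i j l \<le> (SUP n. x n (k n) l)" for i j
    proof -
      have "x i j l \<le> x i (max i j) l" using l by (intro x_mono) auto
      also have "\<dots> \<le> x (max i j) (k (max i j)) l" using k(1)[of "max i j"] l by (auto simp: P_def)
      finally show ?thesis by (rule SUP_upper2[OF UNIV_I])
    qed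
    then show "(SUP i. f i l) \<le> (SUP n. x n (k n) l)"
      unfolding f[OF l] by (intro SUP_least)
  qed
  then show ?thesis using k(2) by blast
qed

definition way_below_rep :: "(nat \<Rightarrow> real) \<Rightarrow> (nat \<Rightarrow> 'a) \<Rightarrow> (('a \<Rightarrow> ennreal) \<Rightarrow> ennreal) \<Rightarrow> bool" where
  "way_below_rep c s f \<longleftrightarrow> (\<forall>n. c n \<in> \<rat> \<and> 0 < c n \<and> s n \<in> carrier S) \<and>
    (\<forall>n. pointwise_way_below S (scaled_hat S (c n) (s n)) (scaled_hat S (c (Suc n)) (s (Suc n)))) \<and>
    (\<forall>l\<in>functionals S. f l = (SUP n. ennreal (c n) * l (s n)))"

lemma way_below_rep_increasing:
  assumes "way_below_rep c s f"
  shows "increasing (realification S) (\<lambda>n. scaled_hat S (c n) (s n))"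
proof -
  have "scaled_hat S (c n) (s n) \<in> carrier (realification S)" for n
    using assms by (intro scaled_hat_in_realification) (auto simp: way_below_rep_def)
  then show ?thesis
    using assms pointwise_way_below_imp_le unfolding increasing_def way_below_rep_def by blast
qed

lemma way_below_rep_imp_rep:
  assumes "way_below_rep c s f" "f \<in> extensional (functionals S)"
  shows "realification_rep S c s f"
  using way_below_rep_increasing[OF assms(1)] assms
  by (intro realification_repI) (auto simp: way_below_rep_def increasing_realification_iff)

text \<open>Each term of a representation is approximated twice at once: its element by a way-below
  chain of \<open>S\<close>, its coefficient by factors tending to 1. The array is then
  diagonalized. The last conjunct records the gap that remains between a term and f, in the
  coefficient and in the element; O3, O5 and the convergence estimate are read off from this
  gap.\<close>

lemma way_below_rep_exists:
  assumes f: "f \<in> carrier (realification S)"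
  shows "\<exists>c s. way_below_rep c s f \<and> (\<forall>n. \<exists>d t. d \<in> \<rat> \<and> c n < d \<and> t \<in> carrier S \<and>
    way_below S (s n) t \<and> scaled_hat S d t \<sqsubseteq>\<^bsub>realification S\<^esub> f)"
proof -
  let ?F = "functionals S" and ?R = "realification S"
  obtain c s where rep: "realification_rep S c s f" using f by (rule realification_rep_obtain)
  note c = realification_rep_Rats[OF rep] realification_rep_pos[OF rep]
    and s = realification_rep_carrier[OF rep] and f_eq = realification_rep_SUP[OF rep]
  have "\<forall>i. \<exists>t. increasing S t \<and> is_seq_sup S t (s i) \<and> (\<forall>n. way_below S (t n) (t (Suc n))) \<and>
    (\<forall>n. way_below S (t n) (s i))"
    using way_below_chain[OF O2 s] by metis
  then obtain t where t: "\<And>i. increasing S (t i)" "\<And>i. is_seq_sup S (t i) (s i)"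
    "\<And>i n. way_below S (t i n) (t i (Suc n))" "\<And>i n. way_below S (t i n) (s i)"
    by metis
  note tC = increasing_carrier[OF t(1)]
  define r where "r j = real (Suc j) / real (Suc (Suc j))" for j
  have r: "0 < r j" "r j < 1" "r j < r (Suc j)" "r j \<in> \<rat>" for j
    by (auto simp: r_def field_simps)
  define x where "x i j = scaled_hat S (c i * r j) (t i j)" for i j
  have x_in: "x i j \<in> carrier ?R" for i j
    unfolding x_def using c r tC by (intro scaled_hat_in_realification) auto
  have x_wb: "pointwise_way_below S (x i j) (x i (Suc j))" for i j
    unfolding x_def using c r tC t by (intro pointwise_way_below_scaled_hat) auto
  have SUP_r: "(SUP j. ennreal (r j)) = 1" unfolding r_def by (rule SUP_Suc_over_Suc_Suc)
  have x_sup: "ennreal (c i) * l (s i) = (SUP j. x i j l)" if l: "l \<in> ?F" for i l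
  proof -
    have inc_l: "incseq (\<lambda>j. l (t i j))"
      using increasing_incseq[OF t(1)] functionals_mono[OF l] by blast
    have inc_r: "incseq (\<lambda>j. ennreal (r j))"
      using r by (intro incseq_SucI ennreal_leI) (simp add: less_imp_le)
    have "(SUP j. x i j l) = (SUP j. ennreal (c i) * (ennreal (r j) * l (t i j)))"
      using l c r by (simp add: x_def ennreal_mult mult.assoc less_imp_le)
    also have "\<dots> = ennreal (c i) * (SUP j. ennreal (r j) * l (t i j))"
      by (simp add: SUP_mult_left_ennreal)
    also have "(SUP j. ennreal (r j) * l (t i j)) = (SUP j. ennreal (r j)) * (SUP j. l (t i j))"
    proof (rule antisym)
      show "(SUP j. ennreal (r j) * l (t i j)) \<le> (SUP j. ennreal (r j)) * (SUP j. l (t i j))"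
        by (intro SUP_least mult_mono SUP_upper) auto
      \<comment> \<open>Both factors increase, so a product with two indices is bounded by the
        product at their maximum.\<close>
      have "ennreal (r j) * l (t i j') \<le> (SUP j. ennreal (r j) * l (t i j))" for j j'
        by (rule SUP_upper2[of "max j j'"]) (auto intro!: mult_mono monoD[OF inc_l] monoD[OF inc_r])
      then show "(SUP j. ennreal (r j)) * (SUP j. l (t i j)) \<le> (SUP j. ennreal (r j) * l (t i j))"
        by (auto simp: SUP_mult_left_ennreal SUP_mult_right_ennreal intro!: SUP_least)
    qed
    also have "\<dots> = l (s i)" using functionals_sup[OF l t(1,2)] by (simp add: SUP_r)
    finally show ?thesis by simp
  qed
  have "\<exists>k. (\<forall>n. pointwise_way_below S (x n (k n)) (x (Suc n) (k (Suc n)))) \<and>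
    (\<forall>l\<in>?F. (SUP n. x n (k n) l) = (SUP i. ennreal (c i) * l (s i)))"
    by (rule realification_diagonal)
      (use x_in x_wb x_sup realification_rep_mono[OF rep] in auto)
  then obtain k where k: "\<And>n. pointwise_way_below S (x n (k n)) (x (Suc n) (k (Suc n)))"
    "\<And>l. l \<in> ?F \<Longrightarrow> (SUP n. x n (k n) l) = (SUP i. ennreal (c i) * l (s i))" by blast
  have "way_below_rep (\<lambda>n. c n * r (k n)) (\<lambda>n. t n (k n)) f"
    using c r tC k(1) k(2)[symmetric] by (simp add: way_below_rep_def x_def f_eq)
  moreover have "\<exists>d u. d \<in> \<rat> \<and> c n * r (k n) < d \<and> u \<in> carrier S \<and>
    way_below S (t n (k n)) u \<and> scaled_hat S d u \<sqsubseteq>\<^bsub>?R\<^esub> f" for n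
  proof (intro exI conjI)
    show "scaled_hat S (c n) (s n) \<sqsubseteq>\<^bsub>?R\<^esub> f" by (auto simp: f_eq intro: SUP_upper)
    show "c n * r (k n) < c n" using c(2)[of n] r(2)[of "k n"] by simp
  qed (use c s t in auto)
  ultimately show ?thesis by blast
qed

text \<open>Each member is first represented by a way-below chain, which is what allows a single
  increasing sequence to be extracted from the array of all representations.\<close>

lemma SUP_in_realification:
  assumes f: "increasing (realification S) f"
  shows "(\<lambda>l\<in>functionals S. SUP i. f i l) \<in> carrier (realification S)"
proof -
  let ?F = "functionals S" and ?R = "realification S"
  have "\<forall>i. \<exists>c s. way_below_rep c s (f i)"
    using way_below_rep_exists f by (auto simp: increasing_realification_iff) blast
  then obtain c s where rep: "\<And>i. way_below_rep (c i) (s i) (f i)" by metis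
  have "\<exists>k. (\<forall>n. pointwise_way_below S (scaled_hat S (c n (k n)) (s n (k n)))
      (scaled_hat S (c (Suc n) (k (Suc n))) (s (Suc n) (k (Suc n))))) \<and>
    (\<forall>l\<in>?F. (SUP n. scaled_hat S (c n (k n)) (s n (k n)) l) = (SUP i. f i l))"
    by (rule realification_diagonal)
      (use rep f in \<open>auto simp: way_below_rep_def increasing_realification_iff
        intro: scaled_hat_in_realification\<close>)
  then obtain k where k: "\<And>n. pointwise_way_below S (scaled_hat S (c n (k n)) (s n (k n)))
      (scaled_hat S (c (Suc n) (k (Suc n))) (s (Suc n) (k (Suc n))))"
    "\<And>l. l \<in> ?F \<Longrightarrow> (SUP n. scaled_hat S (c n (k n)) (s n (k n)) l) = (SUP i. f i l)" by blast
  have "way_below_rep (\<lambda>n. c n (k n)) (\<lambda>n. s n (k n)) (\<lambda>l\<in>?F. SUP i. f i l)"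
    using rep k(1) k(2)[symmetric] by (simp add: way_below_rep_def)
  then show ?thesis
    by (intro realification_rep_in_realification way_below_rep_imp_rep) auto
qed

lemma is_seq_sup_realification_SUP:
  assumes "increasing (realification S) f"
  shows "is_seq_sup (realification S) f (\<lambda>l\<in>functionals S. SUP i. f i l)"
  using SUP_in_realification[OF assms] assms
  by (intro is_seq_supI) (auto simp: increasing_realification_iff intro: SUP_upper SUP_least)

lemma is_seq_sup_realification_iff:
  assumes "increasing (realification S) f"
  shows "is_seq_sup (realification S) f g \<longleftrightarrow> g = (\<lambda>l\<in>functionals S. SUP i. f i l)"
proof
  interpret R: ordered_semigroup "realification S" by (rule ordered_semigroup_realification)
  assume "is_seq_sup (realification S) f g"
  then show "g = (\<lambda>l\<in>functionals S. SUP i. f i l)"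
    using is_seq_sup_realification_SUP[OF assms] R.least_unique unfolding is_seq_sup_def by blast
qed (use is_seq_sup_realification_SUP[OF assms] in simp)

lemma is_seq_sup_realification_apply:
  assumes "increasing (realification S) f" "is_seq_sup (realification S) f g" "l \<in> functionals S"
  shows "g l = (SUP i. f i l)"
  using assms by (simp add: is_seq_sup_realification_iff)

lemma way_below_realification_iff:
  "way_below (realification S) x y \<longleftrightarrow> pointwise_way_below S x y"
proof
  assume "way_below (realification S) x y"
  then show "pointwise_way_below S x y"
    unfolding way_below_def pointwise_way_below_def
    using is_seq_sup_realification_SUP by fastforce
next
  assume xy: "pointwise_way_below S x y"
  show "way_below (realification S) x y"
    unfolding way_below_def
  proof (intro allI impI, elim conjE)
    fix t u assume "increasing (realification S) t" "is_seq_sup (realification S) t u"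
      "y \<sqsubseteq>\<^bsub>realification S\<^esub> u"
    then show "\<exists>n. x \<sqsubseteq>\<^bsub>realification S\<^esub> t n"
      using xy is_seq_sup_realification_apply unfolding pointwise_way_below_def by fastforce
  qed
qed

lemma way_below_scaled_hat:
  assumes "s' \<in> carrier S" "s \<in> carrier S" "way_below S s' s" "0 < c" "c < d"
  shows "way_below (realification S) (scaled_hat S c s') (scaled_hat S d s)"
  using pointwise_way_below_scaled_hat[OF assms] by (simp only: way_below_realification_iff)

lemma realification_basic_chain:
  assumes f: "f \<in> carrier (realification S)"
  shows "\<exists>c s. (\<forall>n. c n \<in> \<rat> \<and> 0 < c n \<and> s n \<in> carrier S) \<and>
    (\<forall>n. way_below (realification S) (scaled_hat S (c n) (s n)) (scaled_hat S (c (Suc n)) (s (Suc n)))) \<and>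
    increasing (realification S) (\<lambda>n. scaled_hat S (c n) (s n)) \<and>
    is_seq_sup (realification S) (\<lambda>n. scaled_hat S (c n) (s n)) f \<and>
    (\<forall>n. \<exists>d t. d \<in> \<rat> \<and> c n < d \<and> t \<in> carrier S \<and>
      way_below S (s n) t \<and> scaled_hat S d t \<sqsubseteq>\<^bsub>realification S\<^esub> f)"
proof -
  obtain c s where rep: "way_below_rep c s f" and dt: "\<forall>n. \<exists>d t. d \<in> \<rat> \<and> c n < d \<and> t \<in> carrier S \<and>
    way_below S (s n) t \<and> scaled_hat S d t \<sqsubseteq>\<^bsub>realification S\<^esub> f"
    using way_below_rep_exists[OF f] by blast
  have "f = (\<lambda>l\<in>functionals S. SUP n. scaled_hat S (c n) (s n) l)"
    using rep realification_extensional[OF f]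
    by (intro realification_eqI) (auto simp: way_below_rep_def)
  then have "is_seq_sup (realification S) (\<lambda>n. scaled_hat S (c n) (s n)) f"
    using is_seq_sup_realification_iff[OF way_below_rep_increasing[OF rep]] by blast
  then show ?thesis
    using rep dt way_below_rep_increasing[OF rep] unfolding way_below_rep_def way_below_realification_iff
    by (intro exI[of _ c] exI[of _ s]) blast
qed

section \<open>The axioms O1 to O4 for the realification\<close>

lemma axiom_O1_realification: "axiom_O1 (realification S)"
  unfolding axiom_O1_def using is_seq_sup_realification_SUP by blast

lemma axiom_O2_realification: "axiom_O2 (realification S)"
  unfolding axiom_O2_def
proof
  fix f assume "f \<in> carrier (realification S)"
  then obtain c s where "\<forall>n. way_below (realification S) (scaled_hat S (c n) (s n)) (scaled_hat S (c (Suc n)) (s (Suc n)))"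
    "increasing (realification S) (\<lambda>n. scaled_hat S (c n) (s n))"
    "is_seq_sup (realification S) (\<lambda>n. scaled_hat S (c n) (s n)) f"
    using realification_basic_chain by blast
  then show "\<exists>x. (\<forall>n. x n \<in> carrier (realification S)) \<and>
      (\<forall>n. way_below (realification S) (x n) (x (Suc n))) \<and> is_seq_sup (realification S) x f"
    using increasing_carrier by (intro exI[of _ "\<lambda>n. scaled_hat S (c n) (s n)"]) blast
qed

text \<open>An element way below f is absorbed by one member of an approximating chain, and that
  member lies inside f with room in both coefficient and element. Questions about the realification
  are thereby reduced to a way-below pair of \<open>S\<close> and two rational numbers.\<close>

lemma way_below_realificationE:
  assumes f: "f \<in> carrier (realification S)" and wb: "way_below (realification S) x f"
  shows "\<exists>c s d t. c \<in> \<rat> \<and> 0 < c \<and> s \<in> carrier S \<and> d \<in> \<rat> \<and> c < d \<and> t \<in> carrier S \<and>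
    way_below S s t \<and> x \<sqsubseteq>\<^bsub>realification S\<^esub> scaled_hat S c s \<and>
    scaled_hat S d t \<sqsubseteq>\<^bsub>realification S\<^esub> f"
proof -
  obtain c s where c: "\<forall>n. c n \<in> \<rat> \<and> 0 < c n \<and> s n \<in> carrier S"
    and inc: "increasing (realification S) (\<lambda>n. scaled_hat S (c n) (s n))"
    and sup: "is_seq_sup (realification S) (\<lambda>n. scaled_hat S (c n) (s n)) f"
    and dt: "\<forall>n. \<exists>d t. d \<in> \<rat> \<and> c n < d \<and> t \<in> carrier S \<and>
      way_below S (s n) t \<and> scaled_hat S d t \<sqsubseteq>\<^bsub>realification S\<^esub> f"
    using realification_basic_chain[OF f] by blast
  have "f \<sqsubseteq>\<^bsub>realification S\<^esub> f" by simp
  then obtain n where n: "x \<sqsubseteq>\<^bsub>realification S\<^esub> scaled_hat S (c n) (s n)"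
    using wb inc sup unfolding way_below_def by blast
  obtain d t where "d \<in> \<rat>" "c n < d" "t \<in> carrier S" "way_below S (s n) t"
    "scaled_hat S d t \<sqsubseteq>\<^bsub>realification S\<^esub> f"
    using dt[rule_format, of n] by blast
  then show ?thesis
    using c n by (intro exI[of _ "c n"] exI[of _ "s n"] exI[of _ d] exI[of _ t]) simp
qed

lemma axiom_O3_realification: "axiom_O3 (realification S)"
  unfolding axiom_O3_def
proof (intro ballI impI, elim conjE)
  let ?F = "functionals S" and ?R = "realification S"
  interpret R: ordered_semigroup ?R by (rule ordered_semigroup_realification)
  fix x\<^sub>1 y\<^sub>1 x\<^sub>2 y\<^sub>2
  assume C: "x\<^sub>1 \<in> carrier ?R" "y\<^sub>1 \<in> carrier ?R" "x\<^sub>2 \<in> carrier ?R" "y\<^sub>2 \<in> carrier ?R"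
    and wb: "way_below ?R x\<^sub>1 y\<^sub>1" "way_below ?R x\<^sub>2 y\<^sub>2"
  obtain c\<^sub>1 s\<^sub>1 d\<^sub>1 t\<^sub>1 where 1: "c\<^sub>1 \<in> \<rat>" "0 < c\<^sub>1" "s\<^sub>1 \<in> carrier S" "d\<^sub>1 \<in> \<rat>" "c\<^sub>1 < d\<^sub>1" "t\<^sub>1 \<in> carrier S"
    "way_below S s\<^sub>1 t\<^sub>1" "x\<^sub>1 \<sqsubseteq>\<^bsub>?R\<^esub> scaled_hat S c\<^sub>1 s\<^sub>1" "scaled_hat S d\<^sub>1 t\<^sub>1 \<sqsubseteq>\<^bsub>?R\<^esub> y\<^sub>1"
    using way_below_realificationE[OF C(2) wb(1)] by blast
  obtain c\<^sub>2 s\<^sub>2 d\<^sub>2 t\<^sub>2 where 2: "c\<^sub>2 \<in> \<rat>" "0 < c\<^sub>2" "s\<^sub>2 \<in> carrier S" "d\<^sub>2 \<in> \<rat>" "c\<^sub>2 < d\<^sub>2" "t\<^sub>2 \<in> carrier S"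
    "way_below S s\<^sub>2 t\<^sub>2" "x\<^sub>2 \<sqsubseteq>\<^bsub>?R\<^esub> scaled_hat S c\<^sub>2 s\<^sub>2" "scaled_hat S d\<^sub>2 t\<^sub>2 \<sqsubseteq>\<^bsub>?R\<^esub> y\<^sub>2"
    using way_below_realificationE[OF C(4) wb(2)] by blast
  have d: "0 < d\<^sub>1" "0 < d\<^sub>2" using 1 2 by auto
  obtain p\<^sub>1 q\<^sub>1 :: nat where pq1: "0 < q\<^sub>1" "d\<^sub>1 = real p\<^sub>1 / real q\<^sub>1"
    using pos_Rats_obtain[OF 1(4)] d(1) by blast
  obtain p\<^sub>2 q\<^sub>2 :: nat where pq2: "0 < q\<^sub>2" "d\<^sub>2 = real p\<^sub>2 / real q\<^sub>2"
    using pos_Rats_obtain[OF 2(4)] d(2) by blast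
  \<comment> \<open>With the common unit e both upper coefficients become integers, so that the two
    pairs can be added in \<open>S\<close>.\<close>
  define e where "e = 1 / (real q\<^sub>1 * real q\<^sub>2)"
  \<comment> \<open>One ratio a < 1 covers both gaps: enlarging each lower coefficient to a times
    its upper one gives both the same relative gap.\<close>
  define a where "a = max (c\<^sub>1 / d\<^sub>1) (c\<^sub>2 / d\<^sub>2)"
  have a: "0 < a" "a < 1" "c\<^sub>1 \<le> a * d\<^sub>1" "c\<^sub>2 \<le> a * d\<^sub>2"
    using 1 2 d by (auto simp: a_def less_max_iff_disj pos_divide_le_eq[symmetric])
  have e: "0 < e" "d\<^sub>1 = e * real (p\<^sub>1 * q\<^sub>2)" "d\<^sub>2 = e * real (p\<^sub>2 * q\<^sub>1)"
    using pq1 pq2 by (auto simp: e_def)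
  let ?s = "(p\<^sub>1 * q\<^sub>2) \<odot> s\<^sub>1 \<oplus> (p\<^sub>2 * q\<^sub>1) \<odot> s\<^sub>2" and ?t = "(p\<^sub>1 * q\<^sub>2) \<odot> t\<^sub>1 \<oplus> (p\<^sub>2 * q\<^sub>1) \<odot> t\<^sub>2"
  have combine: "ennreal (b * e) * l ((p\<^sub>1 * q\<^sub>2) \<odot> x \<oplus> (p\<^sub>2 * q\<^sub>1) \<odot> y) =
      ennreal (b * d\<^sub>1) * l x + ennreal (b * d\<^sub>2) * l y"
    if "0 < b" "x \<in> carrier S" "y \<in> carrier S" "l \<in> ?F" for b x y l
  proof -
    have "ennreal (b * d\<^sub>1) = ennreal (b * e) * ennreal (real (p\<^sub>1 * q\<^sub>2))"
      "ennreal (b * d\<^sub>2) = ennreal (b * e) * ennreal (real (p\<^sub>2 * q\<^sub>1))"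
      using that e by (simp_all add: mult.assoc flip: ennreal_mult del: of_nat_mult)
    then show ?thesis
      using that by (simp add: functionals_add functionals_mult ennreal_of_nat_eq_real_of_nat
          distrib_left mult.assoc del: of_nat_mult)
  qed
  have "way_below S ?s ?t"
    using O3 way_below_mult[OF O3] 1 2 unfolding axiom_O3_def by blast
  then have wb': "way_below ?R (scaled_hat S (a * e) ?s) (scaled_hat S (1 * e) ?t)"
    using 1 2 a e by (intro way_below_scaled_hat) auto
  show "way_below ?R (x\<^sub>1 \<oplus>\<^bsub>?R\<^esub> x\<^sub>2) (y\<^sub>1 \<oplus>\<^bsub>?R\<^esub> y\<^sub>2)"
    unfolding way_below_realification_iff
  proof (rule pointwise_way_below_mono)
    show "pointwise_way_below S (scaled_hat S (a * e) ?s) (scaled_hat S (1 * e) ?t)"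
      using wb' by (simp only: way_below_realification_iff)
    have "x\<^sub>1 l + x\<^sub>2 l \<le> ennreal (a * e) * l ?s" if l: "l \<in> ?F" for l
    proof -
      have "x\<^sub>1 l + x\<^sub>2 l \<le> ennreal c\<^sub>1 * l s\<^sub>1 + ennreal c\<^sub>2 * l s\<^sub>2" using 1 2 l by (intro add_mono) auto
      also have "\<dots> \<le> ennreal (a * d\<^sub>1) * l s\<^sub>1 + ennreal (a * d\<^sub>2) * l s\<^sub>2"
        using a by (intro add_mono mult_right_mono ennreal_leI) auto
      finally show ?thesis using combine a 1 2 l by simp
    qed
    then show "x\<^sub>1 \<oplus>\<^bsub>?R\<^esub> x\<^sub>2 \<sqsubseteq>\<^bsub>?R\<^esub> scaled_hat S (a * e) ?s" by simp
    have "ennreal (1 * e) * l ?t \<le> y\<^sub>1 l + y\<^sub>2 l" if l: "l \<in> ?F" for l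
      unfolding combine[OF zero_less_one 1(6) 2(6) l] using 1 2 l by (intro add_mono) auto
    then show "scaled_hat S (1 * e) ?t \<sqsubseteq>\<^bsub>?R\<^esub> y\<^sub>1 \<oplus>\<^bsub>?R\<^esub> y\<^sub>2" by simp
  qed
qed

lemma axiom_O4_realification: "axiom_O4 (realification S)"
  unfolding axiom_O4_def
proof (intro allI impI, elim conjE)
  let ?R = "realification S"
  fix s t x y assume st: "increasing ?R s" "increasing ?R t"
    and xy: "is_seq_sup ?R s x" "is_seq_sup ?R t y"
  have inc: "increasing ?R (\<lambda>n. s n \<oplus>\<^bsub>?R\<^esub> t n)"
    using st by (auto simp: increasing_realification_iff add_in_realification add_mono)
  have "x \<oplus>\<^bsub>?R\<^esub> y = (\<lambda>l\<in>functionals S. SUP n. (s n \<oplus>\<^bsub>?R\<^esub> t n) l)"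
  proof (rule realification_eqI[of _ S])
    fix l assume l: "l \<in> functionals S"
    have "incseq (\<lambda>n. s n l)" "incseq (\<lambda>n. t n l)"
      using st l by (auto simp: increasing_realification_iff intro: incseq_SucI)
    then show "(x \<oplus>\<^bsub>?R\<^esub> y) l = (\<lambda>l\<in>functionals S. SUP n. (s n \<oplus>\<^bsub>?R\<^esub> t n) l) l"
      using l is_seq_sup_realification_apply[OF st(1) xy(1) l] is_seq_sup_realification_apply[OF st(2) xy(2) l]
      by (simp add: ennreal_SUP_add)
  qed (auto simp: realification_def)
  then show "is_seq_sup ?R (\<lambda>n. s n \<oplus>\<^bsub>?R\<^esub> t n) (x \<oplus>\<^bsub>?R\<^esub> y)"
    by (simp only: is_seq_sup_realification_iff[OF inc])
qed

lemma cu_semigroup_realification: "cu_semigroup (realification S)"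
  using ordered_semigroup_realification axiom_O1_realification axiom_O2_realification
    axiom_O3_realification axiom_O4_realification
  by (simp add: cu_semigroup_def cu_semigroup_axioms_def)

end

section \<open>Complements in the realification\<close>

lemma ennreal_scale_mult:
  assumes "a = b * real n" "0 \<le> b"
  shows "ennreal a * x = ennreal b * (of_nat n * x)"
  using assms by (simp add: ennreal_mult ennreal_of_nat_eq_real_of_nat mult.assoc)

lemma ennreal_mult_mult:
  "0 \<le> a \<Longrightarrow> 0 \<le> b \<Longrightarrow> ennreal a * (ennreal b * x) = ennreal (a * b) * x"
  by (simp add: ennreal_mult mult.assoc)

lemma ennreal_inverse_mult_cancel:
  "0 < c \<Longrightarrow> ennreal (1 / c) * (ennreal c * x) = x" "0 < c \<Longrightarrow> ennreal c * (ennreal (1 / c) * x) = x"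
  by (simp_all add: mult.assoc[symmetric] ennreal_mult[symmetric])

context cu_semigroup
begin

text \<open>Put x' below c s and e u below x with c < e and s way below u. Clearing denominators
  turns e u \<le> d t into a pointwise inequality of elements of \<open>S\<close>;
  \<open>le_of_functionals_le\<close> makes it an inequality of multiples, and O5 in
  \<open>S\<close> gives a complement r. Scaling r back by k yields the complement wanted.\<close>

lemma realification_O5_scaled_hat:
  assumes O5: "axiom_O5 S" and x: "x \<in> carrier (realification S)" "way_below (realification S) x' x"
    and d: "d \<in> \<rat>" "0 < d" and t: "t \<in> carrier S"
    and le: "x \<sqsubseteq>\<^bsub>realification S\<^esub> scaled_hat S d t"
  shows "\<exists>h\<in>carrier (realification S). \<forall>l\<in>functionals S.
    x' l + h l \<le> ennreal d * l t \<and> ennreal d * l t \<le> x l + h l"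
proof -
  let ?F = "functionals S" and ?R = "realification S"
  obtain c s e u where c: "c \<in> \<rat>" "0 < c" and s: "s \<in> carrier S" and e: "e \<in> \<rat>" "c < e"
    and u: "u \<in> carrier S" "way_below S s u"
    and x'_le: "x' \<sqsubseteq>\<^bsub>?R\<^esub> scaled_hat S c s" and u_le: "scaled_hat S e u \<sqsubseteq>\<^bsub>?R\<^esub> x"
    using way_below_realificationE[OF x] by blast
  have e_pos: "0 < e" using c e by simp
  obtain p q :: nat where pq: "0 < q" "e = real p / real q" using pos_Rats_obtain[OF e(1) e_pos] by blast
  obtain p' q' :: nat where pq': "0 < q'" "d = real p' / real q'" using pos_Rats_obtain[OF d] by blast
  define A B where "A = p * q'" and "B = p' * q"
  have AB: "real q * real q' * e = real A" "real q * real q' * d = real B"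
    using pq pq' by (simp_all add: A_def B_def)
  \<comment> \<open>The way-below gap is spent twice: from u to v for the inequality of multiples,
    from v to s for O5.\<close>
  obtain v where v: "v \<in> carrier S" "way_below S s v" "way_below S v u"
    using way_below_interpolation[OF s u] by blast
  have le': "l (A \<odot> u) \<le> l (B \<odot> t)" if l: "l \<in> ?F" for l
  proof -
    have "ennreal e * l u \<le> x l" "x l \<le> ennreal d * l t" using u_le le l by simp_all
    then have "ennreal e * l u \<le> ennreal d * l t" by (rule order_trans)
    then have "ennreal (real q * real q') * (ennreal e * l u) \<le> ennreal (real q * real q') * (ennreal d * l t)"
      by (rule mult_left_mono) simp
    moreover have "ennreal (real q * real q') * (ennreal e * l u) = ennreal (real A) * l u"
      "ennreal (real q * real q') * (ennreal d * l t) = ennreal (real B) * l t"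
      using AB e_pos d by (simp_all add: ennreal_mult_mult)
    ultimately show ?thesis
      using l u t by (simp add: functionals_mult ennreal_of_nat_eq_real_of_nat)
  qed
  obtain M N where MN: "0 < M" "M \<le> N" "c / e * real N < real M" "M \<odot> (A \<odot> v) \<sqsubseteq> N \<odot> (B \<odot> t)"
  proof (rule le_of_functionals_le[of "A \<odot> v" "A \<odot> u" "B \<odot> t" "c / e"])
    show "way_below S (A \<odot> v) (A \<odot> u)" using O3 u v by (intro way_below_mult)
  qed (use u v t le' e c in auto)
  then have "(M * A) \<odot> v \<sqsubseteq> (N * B) \<odot> t" using v t by (simp add: osg_mult_mult)
  moreover have "way_below S ((M * A) \<odot> s) ((M * A) \<odot> v)" using O3 s v by (intro way_below_mult)
  ultimately obtain r where r: "r \<in> carrier S" "(M * A) \<odot> s \<oplus> r \<sqsubseteq> (N * B) \<odot> t"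
    "(N * B) \<odot> t \<sqsubseteq> (M * A) \<odot> v \<oplus> r"
    using O5 s v t unfolding axiom_O5_def by (meson osg_mult_closed)
  \<comment> \<open>With this k the right-hand multiple scales back to d exactly, and the left-hand
    one to (M/N) e. The bounds c/e < M/N \<le> 1 place the latter between c and e, so it still
    dominates c s and stays below e u.\<close>
  define k where "k = 1 / (real N * real q * real q')"
  have k: "0 < k" "k \<in> \<rat>" using MN pq pq' by (auto simp: k_def)
  have kB: "d = k * real (N * B)" using MN pq pq' by (simp add: k_def B_def)
  have kA: "k * real (M * A) = real M / real N * e" using pq pq' by (simp add: k_def A_def)
  have kA_le: "k * real (M * A) \<le> e" unfolding kA using MN e_pos by (simp add: field_simps)
  have kA_ge: "c \<le> k * real (M * A)" unfolding kA using MN e_pos by (simp add: field_simps)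
  show ?thesis
  proof (intro bexI ballI conjI)
    show "scaled_hat S k r \<in> carrier ?R" using k r by (intro scaled_hat_in_realification)
    fix l assume l: "l \<in> ?F"
    have t_eq: "ennreal d * l t = ennreal k * l ((N * B) \<odot> t)"
      using ennreal_scale_mult[OF kB] k l t by (simp only: functionals_mult less_imp_le)
    have A_eq: "ennreal (k * real (M * A)) * l w = ennreal k * l ((M * A) \<odot> w)" if "w \<in> carrier S" for w
      using ennreal_scale_mult[of "k * real (M * A)" k "M * A"] k l that by (simp only: functionals_mult less_imp_le)
    have "x' l + scaled_hat S k r l \<le> ennreal (k * real (M * A)) * l s + ennreal k * l r"
    proof -
      have "x' l \<le> ennreal c * l s" using x'_le l by simp
      also have "\<dots> \<le> ennreal (k * real (M * A)) * l s" using kA_ge by (intro mult_right_mono ennreal_leI) auto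
      finally show ?thesis using l by (simp add: add_mono)
    qed
    also have "\<dots> = ennreal k * l ((M * A) \<odot> s \<oplus> r)"
      unfolding A_eq[OF s] using l s r by (simp add: functionals_add distrib_left)
    also have "\<dots> \<le> ennreal d * l t"
      unfolding t_eq using l s r t by (intro mult_left_mono functionals_mono[OF l]) auto
    finally show "x' l + scaled_hat S k r l \<le> ennreal d * l t" .
    have "ennreal d * l t \<le> ennreal k * l ((M * A) \<odot> v \<oplus> r)"
      unfolding t_eq using l v r t by (intro mult_left_mono functionals_mono[OF l]) auto
    also have "\<dots> = ennreal (k * real (M * A)) * l v + ennreal k * l r"
      unfolding A_eq[OF v(1)] using l v r by (simp add: functionals_add distrib_left)
    also have "\<dots> \<le> x l + scaled_hat S k r l"
    proof -
      have "ennreal (k * real (M * A)) * l v \<le> ennreal e * l u"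
        using kA_le v u l way_below_imp_le by (intro mult_mono ennreal_leI functionals_mono[OF l]) auto
      also have "\<dots> \<le> x l" using u_le l by simp
      finally show ?thesis using l by (simp add: add_mono)
    qed
    finally show "ennreal d * l t \<le> x l + scaled_hat S k r l" .
  qed
qed

text \<open>Shrinking \<open>x\<close> and \<open>y\<close> by a factor \<open>1 - a\<close> leaves room for the summand \<open>a y\<close> of the
  complement, which takes the value \<open>\<infinity>\<close> wherever \<open>y\<close> does. It therefore suffices to find
  complements that increase where \<open>y\<close> is finite. There terms can be cancelled: if
  \<open>e\<^sub>n\<^sub>+\<^sub>1 + h\<^sub>n \<le> K\<^sub>n \<le> e\<^sub>n + h\<^sub>n\<close> for decreasing \<open>e\<^sub>n\<close> and increasing \<open>K\<^sub>n\<close>,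
  then \<open>h\<^sub>n \<le> h\<^sub>n\<^sub>+\<^sub>1\<close>.\<close>

lemma axiom_O5_realification:
  assumes O5: "axiom_O5 S"
  shows "axiom_O5 (realification S)"
  unfolding axiom_O5_def
proof (intro ballI impI, elim conjE)
  let ?F = "functionals S" and ?R = "realification S"
  interpret R: cu_semigroup ?R by (rule cu_semigroup_realification)
  fix x' x y assume x': "x' \<in> carrier ?R" and x: "x \<in> carrier ?R" and y: "y \<in> carrier ?R"
    and wb: "way_below ?R x' x" and xy: "x \<sqsubseteq>\<^bsub>?R\<^esub> y"
  define sc where "sc a f = (\<lambda>l\<in>?F. ennreal a * f l)" for a :: real and f :: "('a \<Rightarrow> ennreal) \<Rightarrow> ennreal"
  have sc_in: "sc a f \<in> carrier ?R" if "f \<in> carrier ?R" "a \<in> \<rat>" "0 < a" for a f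
    unfolding sc_def using that by (rule scale_in_realification)
  have sc_apply: "sc a f l = ennreal a * f l" if "l \<in> ?F" for a f l
    using that by (simp add: sc_def)
  \<comment> \<open>Since x is the supremum of its multiples \<open>r j\<close> x with
    \<open>r j\<close> tending to 1, an element interpolated between x' and x lies below one of
    them; then a = 1 - \<open>r j\<close>.\<close>
  obtain a :: real where a: "a \<in> \<rat>" "0 < a" "a < 1" and wb_a: "way_below ?R x' (sc (1 - a) x)"
  proof -
    define r where "r j = real (Suc j) / real (Suc (Suc j))" for j
    have r: "0 < r j" "r j < 1" "r j \<in> \<rat>" "r j \<le> r (Suc j)" for j by (auto simp: r_def field_simps)
    obtain w where w: "w \<in> carrier ?R" "way_below ?R x' w" "way_below ?R w x"
      using R.way_below_interpolation[OF x' x wb] by blast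
    have "increasing ?R (\<lambda>j. sc (r j) x)"
      using r x by (auto simp: increasing_realification_iff sc_apply sc_in intro!: mult_right_mono ennreal_leI)
    moreover have "x l \<le> (SUP j. sc (r j) x l)" if l: "l \<in> ?F" for l
    proof -
      have "(SUP j. sc (r j) x l) = (SUP j. ennreal (r j)) * x l"
        by (simp add: sc_apply[OF l] SUP_mult_right_ennreal)
      also have "\<dots> = x l" unfolding r_def SUP_Suc_over_Suc_Suc by simp
      finally show ?thesis by simp
    qed
    ultimately obtain j where j: "w \<sqsubseteq>\<^bsub>?R\<^esub> sc (r j) x"
      using w(3) unfolding way_below_realification_iff pointwise_way_below_def by blast
    show thesis
    proof (rule that)
      show "way_below ?R x' (sc (1 - (1 - r j)) x)"
        using w j r x sc_in by (intro R.way_below_le_trans[OF w(2)]) auto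
    qed (use r[of j] in auto)
  qed
  define x1 y1 where "x1 = sc (1 - a) x" and "y1 = sc (1 - a) y"
  have x1: "x1 \<in> carrier ?R" and y1: "y1 \<in> carrier ?R"
    unfolding x1_def y1_def using a x y by (auto intro: sc_in)
  have x1_le: "x1 l \<le> x l" if "l \<in> ?F" for l
    using mult_right_mono[of "ennreal (1 - a)" 1 "x l"] a that by (simp add: x1_def sc_apply ennreal_le_1)
  have x1_y1: "x1 \<sqsubseteq>\<^bsub>?R\<^esub> y1" using xy by (auto simp: x1_def y1_def sc_apply intro: mult_left_mono)
  have y_split: "ennreal (1 - a) * z + ennreal a * z = z" for z
    using a by (simp add: distrib_right[symmetric] ennreal_plus[symmetric] del: ennreal_plus)
  \<comment> \<open>The chain descends, so that the lower bound \<open>e (Suc n)\<close> used for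
    the complement at stage n is the upper bound at stage n + 1; the cancellation depends on this
    coincidence.\<close>
  have "\<exists>e. \<forall>n. (e n \<in> carrier ?R \<and> way_below ?R x' (e n) \<and> way_below ?R (e n) x1) \<and>
    way_below ?R (e (Suc n)) (e n)"
  proof (rule dependent_nat_choice)
    show "\<exists>e. e \<in> carrier ?R \<and> way_below ?R x' e \<and> way_below ?R e x1"
      using R.way_below_interpolation[OF x' x1] wb_a by (auto simp: x1_def)
    fix e :: "('a \<Rightarrow> ennreal) \<Rightarrow> ennreal" and n :: nat
    assume e: "e \<in> carrier ?R \<and> way_below ?R x' e \<and> way_below ?R e x1"
    then obtain z where z: "z \<in> carrier ?R" "way_below ?R x' z" "way_below ?R z e"
      using R.way_below_interpolation[OF x'] by blast
    have "e \<sqsubseteq>\<^bsub>?R\<^esub> x1" using e x1 R.way_below_imp_le by blast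
    then have "way_below ?R z x1" using z e x1 R.way_below_le_trans by blast
    then show "\<exists>z. (z \<in> carrier ?R \<and> way_below ?R x' z \<and> way_below ?R z x1) \<and> way_below ?R z e"
      using z by blast
  qed
  then obtain e where e: "\<And>n. e n \<in> carrier ?R" "\<And>n. way_below ?R x' (e n)"
    "\<And>n. way_below ?R (e n) x1" "\<And>n. way_below ?R (e (Suc n)) (e n)" by blast
  have e_le0: "e n l \<le> e 0 l" if "l \<in> ?F" for n l
  proof (induction n)
    case (Suc n)
    then show ?case using R.way_below_imp_le[OF e(1) e(1) e(4)[of n]] that order_trans by auto
  qed simp
  obtain c s where cs: "\<forall>n. c n \<in> \<rat> \<and> 0 < c n \<and> s n \<in> carrier S"
    and inc: "increasing ?R (\<lambda>n. scaled_hat S (c n) (s n))"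
    and sup: "is_seq_sup ?R (\<lambda>n. scaled_hat S (c n) (s n)) y1"
    using realification_basic_chain[OF y1] by blast
  have c: "c n \<in> \<rat>" "0 < c n" and s: "s n \<in> carrier S" for n using cs by auto
  have "way_below ?R (e 0) y1" using R.way_below_le_trans[OF e(3) x1_y1 x1 y1] .
  then obtain m where m: "e 0 \<sqsubseteq>\<^bsub>?R\<^esub> scaled_hat S (c m) (s m)"
    using inc sup R.le_refl[OF y1] unfolding way_below_def by blast
  define K where "K n l = ennreal (c (m + n)) * l (s (m + n))" for n l
  have c_mono: "ennreal (c i) * l (s i) \<le> ennreal (c j) * l (s j)" if "l \<in> ?F" "i \<le> j" for i j l
    using R.increasing_le[OF inc that(2)] that(1) by simp
  have y1_eq: "y1 l = (SUP n. ennreal (c n) * l (s n))" if "l \<in> ?F" for l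
    using is_seq_sup_realification_apply[OF inc sup that] that by simp
  have K_le: "K n l \<le> y1 l" if "l \<in> ?F" for n l
    unfolding K_def y1_eq[OF that] by (rule SUP_upper) simp
  have K_mono: "K n l \<le> K (Suc n) l" if "l \<in> ?F" for n l
    using that by (simp add: K_def c_mono)
  have K_sup: "y1 l \<le> (SUP n. K n l)" if "l \<in> ?F" for l
    unfolding y1_eq[OF that] K_def using that by (intro SUP_mono' c_mono) auto
  have e_le_K: "e n l \<le> K n l" if l: "l \<in> ?F" for n l
  proof -
    have "e n l \<le> ennreal (c m) * l (s m)" using e_le0[OF l] m l order_trans by fastforce
    also have "\<dots> \<le> K n l" using l by (simp add: K_def c_mono)
    finally show ?thesis .
  qed
  have "\<forall>n. \<exists>h\<in>carrier ?R. \<forall>l\<in>?F. e (Suc n) l + h l \<le> K n l \<and> K n l \<le> e n l + h l"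
    unfolding K_def
    by (intro allI realification_O5_scaled_hat[OF O5 e(1) e(4)] c s)
      (use e_le_K in \<open>auto simp: K_def\<close>)
  then obtain h where h: "\<And>n. h n \<in> carrier ?R"
    "\<And>n l. l \<in> ?F \<Longrightarrow> e (Suc n) l + h n l \<le> K n l" "\<And>n l. l \<in> ?F \<Longrightarrow> K n l \<le> e n l + h n l"
    by metis
  define H where "H n = h n \<oplus>\<^bsub>?R\<^esub> sc a y" for n
  have H_apply: "H n l = h n l + ennreal a * y l" if "l \<in> ?F" for n l
    using that by (simp add: H_def sc_apply)
  have H_mono: "H n l \<le> H (Suc n) l" if l: "l \<in> ?F" for n l
  proof (cases "y l = top")
    case True
    then show ?thesis using a l by (simp add: H_apply ennreal_mult_top)
  next
    case False
    have "y1 l \<noteq> top" using False by (simp add: y1_def sc_apply l ennreal_mult_eq_top_iff)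
    then have fin: "e (Suc n) l \<noteq> \<infinity>"
      using e_le_K[OF l, of "Suc n"] K_le[OF l, of "Suc n"] by (auto simp: top_unique)
    have "e (Suc n) l + h n l \<le> K n l" using h l by simp
    also have "\<dots> \<le> K (Suc n) l" using K_mono l by simp
    also have "\<dots> \<le> e (Suc n) l + h (Suc n) l" using h l by simp
    finally have "h n l \<le> h (Suc n) l" using fin by (simp add: ennreal_add_left_cancel_le)
    then show ?thesis using l by (simp add: H_apply add_mono)
  qed
  have H_inc: "increasing ?R H"
    using H_mono h y a sc_in by (auto simp: increasing_realification_iff H_def intro: add_in_realification)
  show "\<exists>r\<in>carrier ?R. x' \<oplus>\<^bsub>?R\<^esub> r \<sqsubseteq>\<^bsub>?R\<^esub> y \<and> y \<sqsubseteq>\<^bsub>?R\<^esub> x \<oplus>\<^bsub>?R\<^esub> r"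
  proof (intro bexI conjI)
    show "(\<lambda>l\<in>?F. SUP n. H n l) \<in> carrier ?R" using H_inc by (rule SUP_in_realification)
    have "x' l + H n l \<le> y l" if l: "l \<in> ?F" for l n
    proof -
      have "x' l \<le> e (Suc n) l" using R.way_below_imp_le[OF x' e(1) e(2)] l by simp
      then have "x' l + h n l \<le> y1 l"
        using order_trans[OF add_mono[OF _ order_refl] order_trans[OF h(2)[OF l, of n] K_le[OF l, of n]]] by blast
      then have "x' l + h n l + ennreal a * y l \<le> y1 l + ennreal a * y l" by (rule add_mono) simp
      then show ?thesis using l y_split by (simp add: H_apply y1_def sc_apply add.assoc)
    qed
    then show "x' \<oplus>\<^bsub>?R\<^esub> (\<lambda>l\<in>?F. SUP n. H n l) \<sqsubseteq>\<^bsub>?R\<^esub> y"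
      by (auto simp: ennreal_SUP_add_right intro: SUP_least)
    have "y l \<le> x l + (SUP n. H n l)" if l: "l \<in> ?F" for l
    proof -
      have "y l = y1 l + ennreal a * y l" using l y_split by (simp add: y1_def sc_apply)
      also have "\<dots> \<le> (SUP n. K n l) + ennreal a * y l" using K_sup l by (simp add: add_mono)
      also have "\<dots> = (SUP n. K n l + ennreal a * y l)" by (simp add: ennreal_SUP_add_left)
      also have "\<dots> \<le> x l + (SUP n. H n l)"
      proof (rule SUP_least)
        fix n
        have "e n l \<le> x l" using R.way_below_imp_le[OF e(1) x1 e(3)] x1_le[OF l] l order_trans by fastforce
        then have "K n l \<le> x l + h n l" using order_trans[OF h(3)[OF l, of n] add_mono[OF _ order_refl]] by blast
        then have "K n l + ennreal a * y l \<le> x l + H n l"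
          using l by (simp add: H_apply add.assoc[symmetric] add_mono)
        also have "\<dots> \<le> x l + (SUP n. H n l)" by (intro add_mono order_refl SUP_upper) simp
        finally show "K n l + ennreal a * y l \<le> x l + (SUP n. H n l)" .
      qed
      finally show ?thesis .
    qed
    then show "y \<sqsubseteq>\<^bsub>?R\<^esub> x \<oplus>\<^bsub>?R\<^esub> (\<lambda>l\<in>?F. SUP n. H n l)" by simp
  qed
qed

end

section \<open>The isomorphism of cones of functionals\<close>

text \<open>Open sets are defined through convergent filters, so a convergent filter can be pushed
  forward by \<open>filtermap\<close> and tested against an open set of the target.\<close>

lemma continuous_map_functional_topology:
  assumes in_F: "\<And>l. l \<in> functionals S \<Longrightarrow> \<phi> l \<in> functionals T"
    and conv: "\<And>l \<Phi>. functionals_converge S (\<lambda>m. m) l \<Phi> \<Longrightarrow> functionals_converge T \<phi> (\<phi> l) \<Phi>"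
  shows "continuous_map (functional_topology S) (functional_topology T) \<phi>"
  unfolding continuous_map_def topspace_functional_topology openin_functional_topology
proof (intro conjI allI impI)
  fix U assume U: "functional_open T U"
  show "functional_open S {x \<in> functionals S. \<phi> x \<in> U}"
    unfolding functional_open_def
  proof (intro conjI ballI allI impI)
    fix l \<Phi> assume l: "l \<in> {x \<in> functionals S. \<phi> x \<in> U}" and \<Phi>: "functionals_converge S (\<lambda>m. m) l \<Phi>"
    have "functionals_converge T (\<lambda>m. m) (\<phi> l) (filtermap \<phi> \<Phi>)"
      using conv[OF \<Phi>] by (simp flip: functionals_converge_filtermap)
    then have "eventually (\<lambda>m. m \<in> U) (filtermap \<phi> \<Phi>)"
      using U l unfolding functional_open_def by blast
    moreover have "eventually (\<lambda>m. m \<in> functionals S) \<Phi>"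
      using \<Phi> by (simp add: functionals_converge_def)
    ultimately show "eventually (\<lambda>m. m \<in> {x \<in> functionals S. \<phi> x \<in> U}) \<Phi>"
      by (simp add: eventually_filtermap eventually_conj)
  qed auto
qed (use in_F in auto)

definition evaluation :: "'a osg \<Rightarrow> ('a \<Rightarrow> ennreal) \<Rightarrow> (('a \<Rightarrow> ennreal) \<Rightarrow> ennreal) \<Rightarrow> ennreal" where
  "evaluation S l = (\<lambda>f\<in>carrier (realification S). f l)"

text \<open>This is pullback along the canonical map from \<open>S\<close> to its realification; it
  will be the inverse of \<open>evaluation S\<close>.\<close>

definition restrict_to_hats :: "'a osg \<Rightarrow> ((('a \<Rightarrow> ennreal) \<Rightarrow> ennreal) \<Rightarrow> ennreal) \<Rightarrow> 'a \<Rightarrow> ennreal" where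
  "restrict_to_hats S L = (\<lambda>s\<in>carrier S. L (scaled_hat S 1 s))"

lemma realification_in_Lsc: "f \<in> carrier (realification S) \<Longrightarrow> f \<in> Lsc S"
  by (simp add: realification_def)

lemma realification_mult_apply:
  "l \<in> functionals S \<Longrightarrow> (n \<odot>\<^bsub>realification S\<^esub> f) l = of_nat n * f l"
  by (induction n) (auto simp: distrib_right add.commute)

context cu_semigroup
begin

lemma evaluation_in_functionals:
  assumes l: "l \<in> functionals S"
  shows "evaluation S l \<in> functionals (realification S)"
proof (rule functionalsI)
  interpret R: ordered_semigroup "realification S" by (rule ordered_semigroup_realification)
  let ?R = "realification S"
  show "evaluation S l \<zero>\<^bsub>?R\<^esub> = 0" using l by (simp add: evaluation_def)
  fix f g assume "f \<in> carrier ?R" "g \<in> carrier ?R"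
  then show "evaluation S l (f \<oplus>\<^bsub>?R\<^esub> g) = evaluation S l f + evaluation S l g"
    using l by (simp add: evaluation_def)
  show "evaluation S l f \<le> evaluation S l g" if "f \<sqsubseteq>\<^bsub>?R\<^esub> g"
    using l that \<open>f \<in> carrier ?R\<close> \<open>g \<in> carrier ?R\<close> by (simp add: evaluation_def)
next
  fix f x assume fx: "increasing (realification S) f" "is_seq_sup (realification S) f x"
  show "evaluation S l x = (SUP n. evaluation S l (f n))"
    using is_seq_sup_realification_apply[OF fx l] increasing_carrier[OF fx(1)] is_seq_sup_carrier[OF fx(2)]
    by (simp add: evaluation_def)
qed (simp add: evaluation_def)

text \<open>Functionals are only additive by definition. Rational homogeneity follows by clearing
  the denominator: for c = p/q, the q-fold multiple of c x and the p-fold multiple of x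
  coincide.\<close>

lemma functionals_realification_scaled_hat:
  assumes L: "L \<in> functionals (realification S)" and c: "c \<in> \<rat>" "0 < c" and x: "x \<in> carrier S"
  shows "L (scaled_hat S c x) = ennreal c * L (scaled_hat S 1 x)"
proof -
  let ?R = "realification S"
  interpret R: ordered_semigroup ?R by (rule ordered_semigroup_realification)
  obtain p q :: nat where pq: "0 < q" "c = real p / real q" using pos_Rats_obtain[OF c] by blast
  have in_R: "scaled_hat S c x \<in> carrier ?R" "scaled_hat S 1 x \<in> carrier ?R"
    using c x by (auto intro: scaled_hat_in_realification)
  have "q \<odot>\<^bsub>?R\<^esub> scaled_hat S c x = p \<odot>\<^bsub>?R\<^esub> scaled_hat S 1 x"
  proof (rule realification_eqI[of _ S])
    fix l assume l: "l \<in> functionals S"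
    have "of_nat q * (ennreal c * l x) = ennreal (real q * c) * l x"
      using ennreal_mult_mult[of "real q" c] c by (simp add: ennreal_of_nat_eq_real_of_nat)
    also have "real q * c = real p" using pq by simp
    finally show "(q \<odot>\<^bsub>?R\<^esub> scaled_hat S c x) l = (p \<odot>\<^bsub>?R\<^esub> scaled_hat S 1 x) l"
      using l by (simp add: realification_mult_apply ennreal_of_nat_eq_real_of_nat)
  qed (use in_R in \<open>auto intro: realification_extensional\<close>)
  then have "of_nat q * L (scaled_hat S c x) = of_nat p * L (scaled_hat S 1 x)"
    using R.functionals_mult[OF L] in_R by metis
  then have "ennreal (1 / real q) * (ennreal (real q) * L (scaled_hat S c x)) =
      ennreal (1 / real q) * (ennreal (real p) * L (scaled_hat S 1 x))"
    by (simp add: ennreal_of_nat_eq_real_of_nat)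
  then show ?thesis using pq by (simp add: ennreal_mult_mult)
qed

lemma restrict_to_hats_in_functionals:
  assumes L: "L \<in> functionals (realification S)"
  shows "restrict_to_hats S L \<in> functionals S"
proof (rule functionalsI)
  let ?R = "realification S"
  have in_R: "scaled_hat S 1 s \<in> carrier ?R" if "s \<in> carrier S" for s
    using that by (auto intro: scaled_hat_in_realification)
  show "restrict_to_hats S L \<in> extensional (carrier S)" by (simp add: restrict_to_hats_def)
  have "scaled_hat S 1 \<zero> = \<zero>\<^bsub>?R\<^esub>"
    by (rule realification_eqI[of _ S]) (auto simp: scaled_hat_def realification_def functionals_zero)
  then show "restrict_to_hats S L \<zero> = 0"
    using functionals_zero[OF L] by (simp add: restrict_to_hats_def)
  show "restrict_to_hats S L (x \<oplus> y) = restrict_to_hats S L x + restrict_to_hats S L y"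
    if xy: "x \<in> carrier S" "y \<in> carrier S" for x y
  proof -
    have "scaled_hat S 1 (x \<oplus> y) = scaled_hat S 1 x \<oplus>\<^bsub>?R\<^esub> scaled_hat S 1 y"
      using xy by (intro realification_eqI[of _ S]) 
        (auto simp: scaled_hat_def realification_def functionals_add)
    then show ?thesis using functionals_add[OF L in_R in_R] xy by (simp add: restrict_to_hats_def)
  qed
  show "restrict_to_hats S L x \<le> restrict_to_hats S L y"
    if xy: "x \<in> carrier S" "y \<in> carrier S" "x \<sqsubseteq> y" for x y
    using functionals_mono[OF L in_R in_R] xy functionals_mono[OF _ xy] by (simp add: restrict_to_hats_def)
  fix s x assume s: "increasing S s" "is_seq_sup S s x"
  note sC = increasing_carrier[OF s(1)] and xC = is_seq_sup_carrier[OF s(2)]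
  have inc: "increasing ?R (\<lambda>n. scaled_hat S 1 (s n))"
    using s(1) in_R[OF sC] by (auto simp: increasing_realification_iff increasing_def intro: functionals_mono)
  have "scaled_hat S 1 x = (\<lambda>l\<in>functionals S. SUP n. scaled_hat S 1 (s n) l)"
    by (rule realification_eqI[of _ S]) (auto simp: scaled_hat_def functionals_sup[OF _ s])
  then have "is_seq_sup ?R (\<lambda>n. scaled_hat S 1 (s n)) (scaled_hat S 1 x)"
    by (simp only: is_seq_sup_realification_iff[OF inc])
  then show "restrict_to_hats S L x = (SUP n. restrict_to_hats S L (s n))"
    using functionals_sup[OF L inc] sC xC by (simp add: restrict_to_hats_def)
qed

lemma restrict_evaluation:
  assumes l: "l \<in> functionals S"
  shows "restrict_to_hats S (evaluation S l) = l"
proof (rule extensionalityI[of _ "carrier S"])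
  show "restrict_to_hats S (evaluation S l) s = l s" if "s \<in> carrier S" for s
    using that l scaled_hat_in_realification[of 1 s] by (simp add: restrict_to_hats_def evaluation_def)
qed (use functionals_extensional[OF l] in \<open>auto simp: restrict_to_hats_def\<close>)

text \<open>Every f is the supremum of an increasing sequence of rational multiples of elements of
  \<open>S\<close>; L preserves this supremum and is rationally homogeneous.\<close>

lemma evaluation_restrict:
  assumes L: "L \<in> functionals (realification S)"
  shows "evaluation S (restrict_to_hats S L) = L"
proof (rule extensionalityI[of _ "carrier (realification S)"])
  let ?R = "realification S"
  fix f assume f: "f \<in> carrier ?R"
  obtain c s where cs: "\<forall>n. c n \<in> \<rat> \<and> 0 < c n \<and> s n \<in> carrier S"
    and inc: "increasing ?R (\<lambda>n. scaled_hat S (c n) (s n))"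
    and sup: "is_seq_sup ?R (\<lambda>n. scaled_hat S (c n) (s n)) f"
    using realification_basic_chain[OF f] by blast
  note rL = restrict_to_hats_in_functionals[OF L]
  have "L f = (SUP n. L (scaled_hat S (c n) (s n)))" using functionals_sup[OF L inc sup] .
  also have "\<dots> = (SUP n. ennreal (c n) * L (scaled_hat S 1 (s n)))"
    using cs by (intro SUP_cong HOL.refl functionals_realification_scaled_hat[OF L]) auto
  also have "\<dots> = (SUP n. scaled_hat S (c n) (s n) (restrict_to_hats S L))"
    using cs rL by (simp add: restrict_to_hats_def)
  also have "\<dots> = f (restrict_to_hats S L)"
    using is_seq_sup_realification_apply[OF inc sup rL] by simp
  finally show "evaluation S (restrict_to_hats S L) f = L f" using f by (simp add: evaluation_def)
qed (use functionals_extensional[OF L] in \<open>auto simp: evaluation_def\<close>)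

text \<open>For the upper bound, insert f' \<le> c s and d t \<le> f with s way below t and c < d,
  and use the convergence at the pair s, t. The lower bound is lower semicontinuity of f, stated as
  openness of its superlevel sets.\<close>

lemma functionals_converge_evaluation:
  assumes conv: "functionals_converge S (\<lambda>m. m) l \<Phi>"
  shows "functionals_converge (realification S) (evaluation S) (evaluation S l) \<Phi>"
  unfolding functionals_converge_def
proof (intro conjI ballI impI)
  let ?F = "functionals S" and ?R = "realification S"
  have l: "l \<in> ?F" and ev: "eventually (\<lambda>m. m \<in> ?F) \<Phi>"
    using conv by (auto simp: functionals_converge_def)
  show "evaluation S l \<in> functionals ?R" using l by (rule evaluation_in_functionals)
  show "\<forall>\<^sub>F m in \<Phi>. evaluation S m \<in> functionals ?R"
    using ev by (rule eventually_mono) (rule evaluation_in_functionals)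
  fix f' f assume f': "f' \<in> carrier ?R" and f: "f \<in> carrier ?R" and wb: "way_below ?R f' f"
  obtain c s d t where c: "0 < c" "c < d" and st: "s \<in> carrier S" "t \<in> carrier S" "way_below S s t"
    and f'_le: "f' \<sqsubseteq>\<^bsub>?R\<^esub> scaled_hat S c s" and f_ge: "scaled_hat S d t \<sqsubseteq>\<^bsub>?R\<^esub> f"
    using way_below_realificationE[OF f wb] by blast
  have Limsup: "Limsup \<Phi> (\<lambda>m. m s) \<le> l t"
    using conv st by (auto simp: functionals_converge_def)
  show "Limsup \<Phi> (\<lambda>m. evaluation S m f') \<le> evaluation S l f"
    unfolding Limsup_le_iff
  proof (intro allI impI)
    fix y assume y: "evaluation S l f < y"
    have "ennreal c * l t \<le> ennreal d * l t" using c by (intro mult_right_mono ennreal_leI) auto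
    also have "\<dots> \<le> f l" using f_ge l by simp
    also have "\<dots> < y" using y f by (simp add: evaluation_def)
    finally have "ennreal (1 / c) * (ennreal c * l t) < ennreal (1 / c) * y"
      using c by (intro ennreal_mult_strict_left_mono) auto
    then have "l t < ennreal (1 / c) * y" using c by (simp add: ennreal_inverse_mult_cancel)
    then have "eventually (\<lambda>m. m s < ennreal (1 / c) * y) \<Phi>"
      using Limsup unfolding Limsup_le_iff by blast
    with ev show "eventually (\<lambda>m. evaluation S m f' < y) \<Phi>"
    proof eventually_elim
      case (elim m)
      have "evaluation S m f' \<le> ennreal c * m s" using elim f' f'_le by (simp add: evaluation_def)
      also have "\<dots> < ennreal c * (ennreal (1 / c) * y)"
        using elim c by (intro ennreal_mult_strict_left_mono) auto
      finally show ?case using c by (simp add: ennreal_inverse_mult_cancel)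
    qed
  qed
  show "evaluation S l f \<le> Liminf \<Phi> (\<lambda>m. evaluation S m f)"
    unfolding le_Liminf_iff
  proof (intro allI impI)
    fix y assume "y < evaluation S l f"
    then have "l \<in> {l \<in> ?F. y < f l}" using f l by (simp add: evaluation_def)
    moreover have "functional_open S {l \<in> ?F. y < f l}"
      using realification_in_Lsc[OF f] by (simp add: Lsc_def openin_functional_topology)
    ultimately have "eventually (\<lambda>m. m \<in> {l \<in> ?F. y < f l}) \<Phi>"
      using conv unfolding functional_open_def by blast
    then show "eventually (\<lambda>m. y < evaluation S m f) \<Phi>"
      by (rule eventually_mono) (use f in \<open>simp add: evaluation_def\<close>)
  qed
qed

text \<open>If s' is way below s, the image of s' need not be way below that of s: an s that is way
  below itself may lose this property. It is way below (1 + 1/(n+1)) times the image of s, and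
  letting n grow removes the factor.\<close>

lemma functionals_converge_restrict:
  assumes conv: "functionals_converge (realification S) (\<lambda>M. M) L \<Psi>"
  shows "functionals_converge S (restrict_to_hats S) (restrict_to_hats S L) \<Psi>"
  unfolding functionals_converge_def
proof (intro conjI ballI impI)
  let ?R = "realification S"
  interpret R: ordered_semigroup ?R by (rule ordered_semigroup_realification)
  have L: "L \<in> functionals ?R" and ev: "eventually (\<lambda>m. m \<in> functionals ?R) \<Psi>"
    and lim: "\<And>f' f. f' \<in> carrier ?R \<Longrightarrow> f \<in> carrier ?R \<Longrightarrow> way_below ?R f' f \<Longrightarrow>
      Limsup \<Psi> (\<lambda>M. M f') \<le> L f \<and> L f \<le> Liminf \<Psi> (\<lambda>M. M f)"
    using conv by (auto simp: functionals_converge_def)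
  have in_R: "scaled_hat S c s \<in> carrier ?R" if "s \<in> carrier S" "c \<in> \<rat>" "0 < c" for c s
    using that by (auto intro: scaled_hat_in_realification)
  show "restrict_to_hats S L \<in> functionals S" using L by (rule restrict_to_hats_in_functionals)
  show "\<forall>\<^sub>F M in \<Psi>. restrict_to_hats S M \<in> functionals S"
    using ev by (rule eventually_mono) (rule restrict_to_hats_in_functionals)
  fix s' s assume s: "s' \<in> carrier S" "s \<in> carrier S" "way_below S s' s"
  show "restrict_to_hats S L s \<le> Liminf \<Psi> (\<lambda>M. restrict_to_hats S M s)"
    \<comment> \<open>Zero again serves as the way-below element that gives access to the limit
      inferior.\<close>
    using lim[OF zero_in_realification in_R[of s 1] R.zero_way_below] s by (simp add: restrict_to_hats_def)
  have le: "Limsup \<Psi> (\<lambda>M. M (scaled_hat S 1 s')) \<le> ennreal (1 + 1 / real (Suc n)) * L (scaled_hat S 1 s)" for n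
  proof -
    have "way_below ?R (scaled_hat S 1 s') (scaled_hat S (1 + 1 / real (Suc n)) s)"
      using s by (intro way_below_scaled_hat) auto
    then have "Limsup \<Psi> (\<lambda>M. M (scaled_hat S 1 s')) \<le> L (scaled_hat S (1 + 1 / real (Suc n)) s)"
      using lim in_R s by (simp add: add_pos_pos)
    also have "\<dots> = ennreal (1 + 1 / real (Suc n)) * L (scaled_hat S 1 s)"
      using L s by (intro functionals_realification_scaled_hat) (auto intro: add_pos_pos)
    finally show ?thesis .
  qed
  have "Limsup \<Psi> (\<lambda>M. M (scaled_hat S 1 s')) \<le> L (scaled_hat S 1 s)"
  proof (cases "L (scaled_hat S 1 s)")
    case (real a)
    have "(\<lambda>n. (1 + 1 / real (Suc n)) * a) \<longlonglongrightarrow> (1 + 0) * a"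
      by (intro tendsto_intros LIMSEQ_Suc[OF lim_1_over_n])
    then have "(\<lambda>n. ennreal ((1 + 1 / real (Suc n)) * a)) \<longlonglongrightarrow> ennreal a"
      by (intro tendsto_ennrealI) simp
    then show ?thesis
      using le real by (intro LIMSEQ_le_const) (auto simp: ennreal_mult)
  qed simp
  then show "Limsup \<Psi> (\<lambda>M. restrict_to_hats S M s') \<le> restrict_to_hats S L s"
    using s by (simp add: restrict_to_hats_def)
qed

text \<open>Compatibility of \<open>evaluation S\<close> with sums and positive multiples is just
  the linearity of the members of \<open>Lsc S\<close>.\<close>

lemma top_cone_iso_evaluation:
  "top_cone_iso (functional_cone S) (functional_cone (realification S)) (evaluation S)"
proof -
  let ?F = "functionals S" and ?R = "realification S"
  have "homeomorphic_maps (functional_topology S) (functional_topology ?R) (evaluation S) (restrict_to_hats S)"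
    unfolding homeomorphic_maps_def topspace_functional_topology
    by (intro conjI ballI continuous_map_functional_topology evaluation_in_functionals
        restrict_to_hats_in_functionals functionals_converge_evaluation functionals_converge_restrict
        restrict_evaluation evaluation_restrict)
  then have homeo: "homeomorphic_map (functional_topology S) (functional_topology ?R) (evaluation S)"
    by (auto simp: homeomorphic_map_maps)
  moreover have "bij_betw (evaluation S) ?F (functionals ?R)"
    by (rule bij_betw_byWitness[where f' = "restrict_to_hats S"])
      (auto simp: restrict_evaluation evaluation_restrict evaluation_in_functionals restrict_to_hats_in_functionals)
  moreover have "evaluation S (functional_add S l m) = functional_add ?R (evaluation S l) (evaluation S m)"
    if "l \<in> ?F" "m \<in> ?F" for l m
    unfolding evaluation_def functional_add_def[of ?R]
    by (rule restrict_ext) (use that realification_in_Lsc[of _ S] in \<open>simp add: Lsc_def\<close>)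
  moreover have "evaluation S (functional_scale S c l) = functional_scale ?R c (evaluation S l)"
    if "0 < c" "l \<in> ?F" for c l
    unfolding evaluation_def functional_scale_def[of ?R]
    by (rule restrict_ext) (use that realification_in_Lsc[of _ S] in \<open>simp add: Lsc_def\<close>)
  ultimately show ?thesis
    by (simp add: top_cone_iso_def functional_cone_def topspace_functional_topology)
qed

end

theorem proposition3p1p1:
  fixes S :: "'a osg"
  assumes "ordered_semigroup S"
    and "axiom_O1 S" and "axiom_O2 S" and "axiom_O3 S" and "axiom_O4 S" and "axiom_O5 S"
  shows "ordered_semigroup (realification S) \<and>
    axiom_O1 (realification S) \<and> axiom_O2 (realification S) \<and> axiom_O3 (realification S) \<and>
    axiom_O4 (realification S) \<and> axiom_O5 (realification S) \<and>
    functional_cone S \<cong>\<^sub>c functional_cone (realification S)"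
proof -
  interpret cu_semigroup S
    using assms by (simp add: cu_semigroup_def cu_semigroup_axioms_def)
  show ?thesis
    using ordered_semigroup_realification axiom_O1_realification axiom_O2_realification
      axiom_O3_realification axiom_O4_realification axiom_O5_realification[OF assms(6)]
      top_cone_iso_evaluation
    by (auto simp: top_cone_isomorphic_def)
qed

end
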